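(* Let $n,m\ge 1$ be integers, let $f,g_1,\dots,g_m\in\mathbb{R}[\bar z,z]$ be real-valued complex polynomials on $\mathbb{C}^n$, and let $K=\{z\in\mathbb{C}^n : g_i(z)\ge 0,\ i=1,\dots,m\}$. Assume that one of the constraints defining $K$ is a sphere constraint $|z_1|^2+\dots+|z_n|^2=R^2$ for some $R>0$ (that is, both $R^2-\sum_j|z_j|^2$ and its opposite occur among $g_1,\dots,g_m$). Let $\rho_d,\rho_d^*$ be the optimal values of the complex moment and complex sum-of-squares relaxations of order $d$ defined in the context. Then $\rho_d^*=\rho_d\in\mathbb{R}\cup\{+\infty\}$ for all $d\ge d^{\min}$.
   Context: Notation. For $z\in\mathbb{C}^n$, $\alpha\in\mathbb{N}^n$: $z^\alpha=z_1^{\alpha_1}\cdots z_n^{\alpha_n}$, $|\alpha|=\alpha_1+\dots+\alpha_n$, $\bar z$ is the componentwise conjugate. $\mathbb{C}_d[z]$ is the set of holomorphic polynomials $\sum_{|\alpha|\le d}p_\alpha z^\alpha$ ($p_\alpha\in\mathbb{C}$). $\mathbb{R}_d[\bar z,z]$ is the set of functions $\sum_{|\alpha|,|\beta|\le d}\varphi_{\alpha,\beta}\bar z^\alpha z^\beta$ ($\varphi_{\alpha,\beta}\in\mathbb{C}$) that are real-valued on $\mathbb{C}^n$, and $\mathbb{R}[\bar z,z]=\bigcup_d\mathbb{R}_d[\bar z,z]$. $\Sigma_d[z]$ is the set of finite sums $\sum_{j=1}^r|p_j|^2$, $r\ge1$, with $p_j\in\mathbb{C}_d[z]$. Degrees.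 $f\in\mathbb{R}_k[\bar z,z]$, $g_i\in\mathbb{R}_{k_i}[\bar z,z]$, where there exist $|\alpha|=k$, $|\beta|\le k$ with $f_{\alpha,\beta}\ne0$, and $|\alpha|=k_i$, $|\beta|\le k_i$ with $g_{i,\alpha,\beta}\neq0$. Put $g_0:=1$, $k_0:=0$, $d^{\min}:=\max\{k,k_1,\dots,k_m\}$. Moments. $\mathcal{H}_d$ is the set of complex families $y=(y_{\alpha,\beta})_{|\alpha|,|\beta|\le d}$ with $\overline{y_{\alpha,\beta}}=y_{\beta,\alpha}$. $L_y$ is the linear functional with $L_y(\bar z^\alpha z^\beta)=y_{\alpha,\beta}$. For $\varphi=\sum\varphi_{\gamma,\delta}\bar z^\gamma z^\delta$, $M_d(\varphi y)$ is the matrix indexed by $|\alpha|,|\beta|\le d$ with entries $M_d(\varphi y)(\alpha,\beta)=\sum_{\gamma,\delta}\varphi_{\gamma,\delta}\,y_{\alpha+\gamma,\beta+\delta}$. Relaxations. For $d\ge d^{\min}$, $$\rho_d:=\inf_{y\in\mathcal{H}_d}L_y(f)\ \text{ s.t. } y_{0,0}=1,\ M_{d-k_i}(g_iy)\succcurlyeq0,\ i=0,\dots,m,$$ $$\rho_d^*:=\sup\Big\{\lambda\in\mathbb{R} : f-\lambda=\sum_{i=0}^m\sigma_ig_i,\ \sigma_i\in\Sigma_{d-k_i}[z]\Big\}.$$ An infimum over the empty set is $+\infty$, a supremum over the empty set is $-\infty$. *)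

theory Defs
  imports "HOL-Analysis.Analysis" "HOL-Library.Poly_Mapping"
begin

text \<open>The dimension \<open>n\<close> is the cardinality of a finite index type \<open>'n\<close>; points are
  \<^typ>\<open>complex ^ 'n\<close> and multi-indices are \<^typ>\<open>nat ^ 'n\<close>.\<close>

definition mi_deg :: "nat ^ 'n \<Rightarrow> nat" where
  "mi_deg \<alpha> = (\<Sum>i\<in>UNIV. \<alpha> $ i)"

definition mi_le :: "nat \<Rightarrow> (nat ^ 'n) set" where
  "mi_le d = {\<alpha>. mi_deg \<alpha> \<le> d}"

definition vcnj :: "complex ^ 'n \<Rightarrow> complex ^ 'n" where
  "vcnj z = (\<chi> i. cnj (z $ i))"

definition mpow :: "complex ^ 'n \<Rightarrow> nat ^ 'n \<Rightarrow> complex" where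
  "mpow z \<alpha> = (\<Prod>i\<in>UNIV. (z $ i) ^ (\<alpha> $ i))"

text \<open>A polynomial in \<open>z\<close> and its conjugate is given by its finitely supported coefficient family;
  the key \<open>(\<alpha>, \<beta>)\<close> belongs to the monomial in which the conjugate of \<open>z\<close> has exponent \<open>\<alpha>\<close>
  and \<open>z\<close> has exponent \<open>\<beta>\<close>. Such a polynomial is determined by the function it induces.\<close>

type_synonym 'n cpoly = "((nat ^ 'n) \<times> (nat ^ 'n)) \<Rightarrow>\<^sub>0 complex"

definition ceval :: "('n::finite) cpoly \<Rightarrow> complex ^ 'n \<Rightarrow> complex" where
  "ceval \<phi> z = (\<Sum>(\<alpha>, \<beta>)\<in>Poly_Mapping.keys \<phi>. Poly_Mapping.lookup \<phi> (\<alpha>, \<beta>) * mpow (vcnj z) \<alpha> * mpow z \<beta>)"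

definition real_cpoly_le :: "nat \<Rightarrow> ('n::finite) cpoly set" where
  "real_cpoly_le d = {\<phi>. Poly_Mapping.keys \<phi> \<subseteq> mi_le d \<times> mi_le d \<and> (\<forall>z. ceval \<phi> z \<in> \<real>)}"

definition real_cpoly :: "('n::finite) cpoly set" where
  "real_cpoly = (\<Union>d. real_cpoly_le d)"

text \<open>The second disjunct fixes the convention that the zero polynomial has degree \<open>0\<close>.\<close>

definition has_cdegree :: "('n::finite) cpoly \<Rightarrow> nat \<Rightarrow> bool" where
  "has_cdegree \<phi> k \<longleftrightarrow>
     \<phi> \<in> real_cpoly_le k \<and>
     ((\<exists>\<alpha> \<beta>. mi_deg \<alpha> = k \<and> mi_deg \<beta> \<le> k \<and> Poly_Mapping.lookup \<phi> (\<alpha>, \<beta>) \<noteq> 0) \<or> (\<phi> = 0 \<and> k = 0))"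

definition hol_poly_le :: "nat \<Rightarrow> (complex ^ 'n::finite \<Rightarrow> complex) set" where
  "hol_poly_le d = {p. \<exists>c. p = (\<lambda>z. \<Sum>\<alpha>\<in>mi_le d. c \<alpha> * mpow z \<alpha>)}"

definition hsos :: "nat \<Rightarrow> (complex ^ 'n::finite \<Rightarrow> real) set" where
  "hsos d = {\<sigma>. \<exists>(r::nat) p. r \<ge> 1 \<and> (\<forall>j\<in>{1..r}. p j \<in> hol_poly_le d) \<and>
                   \<sigma> = (\<lambda>z. \<Sum>j=1..r. (cmod (p j z))\<^sup>2)}"

text \<open>Families indexed by \<open>|\<alpha>|, |\<beta>| \<le> d\<close> are total functions vanishing at all other indices.\<close>

definition herm_fam :: "nat \<Rightarrow> (nat ^ 'n::finite \<Rightarrow> nat ^ 'n \<Rightarrow> complex) set" where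
  "herm_fam d = {y. (\<forall>\<alpha>\<in>mi_le d. \<forall>\<beta>\<in>mi_le d. cnj (y \<alpha> \<beta>) = y \<beta> \<alpha>) \<and>
                    (\<forall>\<alpha> \<beta>. \<not> (\<alpha> \<in> mi_le d \<and> \<beta> \<in> mi_le d) \<longrightarrow> y \<alpha> \<beta> = 0)}"

definition riesz :: "(nat ^ 'n::finite \<Rightarrow> nat ^ 'n \<Rightarrow> complex) \<Rightarrow> 'n cpoly \<Rightarrow> complex" where
  "riesz y \<phi> = (\<Sum>(\<alpha>, \<beta>)\<in>Poly_Mapping.keys \<phi>. Poly_Mapping.lookup \<phi> (\<alpha>, \<beta>) * y \<alpha> \<beta>)"

text \<open>The order of a localizing matrix is the index set \<^term>\<open>mi_le e\<close> to which \<open>psd_on\<close> restricts it.\<close>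

definition loc_matrix ::
  "('n::finite) cpoly \<Rightarrow> (nat ^ 'n \<Rightarrow> nat ^ 'n \<Rightarrow> complex) \<Rightarrow> nat ^ 'n \<Rightarrow> nat ^ 'n \<Rightarrow> complex" where
  "loc_matrix \<phi> y \<alpha> \<beta> = (\<Sum>(\<gamma>, \<delta>)\<in>Poly_Mapping.keys \<phi>. Poly_Mapping.lookup \<phi> (\<gamma>, \<delta>) * y (\<alpha> + \<gamma>) (\<beta> + \<delta>))"

definition psd_on :: "'i set \<Rightarrow> ('i \<Rightarrow> 'i \<Rightarrow> complex) \<Rightarrow> bool" where
  "psd_on I A \<longleftrightarrow>
     (\<forall>\<alpha>\<in>I. \<forall>\<beta>\<in>I. cnj (A \<alpha> \<beta>) = A \<beta> \<alpha>) \<and>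
     (\<forall>v. 0 \<le> Re (\<Sum>\<alpha>\<in>I. \<Sum>\<beta>\<in>I. cnj (v \<alpha>) * A \<alpha> \<beta> * v \<beta>))"

text \<open>The constraints \<open>g\<close> and their degrees \<open>k\<close> are indexed by \<open>1, \<dots>, m\<close>; the values at \<open>0\<close> are
  overridden by \<open>g\<^sub>0 = 1\<close> and \<open>k\<^sub>0 = 0\<close>.\<close>

definition con :: "(nat \<Rightarrow> ('n::finite) cpoly) \<Rightarrow> nat \<Rightarrow> 'n cpoly" where
  "con g i = (if i = 0 then 1 else g i)"

definition con_deg :: "(nat \<Rightarrow> nat) \<Rightarrow> nat \<Rightarrow> nat" where
  "con_deg k i = (if i = 0 then 0 else k i)"

definition moment_feasible ::
  "nat \<Rightarrow> (nat \<Rightarrow> ('n::finite) cpoly) \<Rightarrow> (nat \<Rightarrow> nat) \<Rightarrow> nat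
     \<Rightarrow> (nat ^ 'n \<Rightarrow> nat ^ 'n \<Rightarrow> complex) set" where
  "moment_feasible m g k d =
     {y \<in> herm_fam d. y 0 0 = 1 \<and>
        (\<forall>i\<in>{0..m}. psd_on (mi_le (d - con_deg k i)) (loc_matrix (con g i) y))}"

text \<open>For Hermitian \<open>y\<close> and real-valued \<open>f\<close> the number \<^term>\<open>riesz y f\<close> is real; \<^const>\<open>Re\<close> only
  adjusts the type. In \<^typ>\<open>ereal\<close> the infimum of the empty set is \<open>\<infinity>\<close> and the supremum of the empty set is
  \<open>-\<infinity>\<close>.\<close>

definition rho ::
  "nat \<Rightarrow> ('n::finite) cpoly \<Rightarrow> (nat \<Rightarrow> 'n cpoly) \<Rightarrow> (nat \<Rightarrow> nat) \<Rightarrow> nat \<Rightarrow> ereal" where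
  "rho m f g k d = (INF y\<in>moment_feasible m g k d. ereal (Re (riesz y f)))"

definition rho_star ::
  "nat \<Rightarrow> ('n::finite) cpoly \<Rightarrow> (nat \<Rightarrow> 'n cpoly) \<Rightarrow> (nat \<Rightarrow> nat) \<Rightarrow> nat \<Rightarrow> ereal" where
  "rho_star m f g k d =
     Sup (ereal ` {l::real. \<exists>\<sigma>. (\<forall>i\<in>{0..m}. \<sigma> i \<in> hsos (d - con_deg k i)) \<and>
            (\<forall>z. ceval f z - of_real l = (\<Sum>i=0..m. of_real (\<sigma> i z) * ceval (con g i) z))})"

end

theory Submission
  imports Defs
begin

text \<open>
  Let \<open>C\<close> be the cone of functions \<open>\<Sum>\<^sub>i \<sigma>\<^sub>i g\<^sub>i\<close> admitted at order \<open>d\<close>. Multiplying the ball constraint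
  \<open>R\<^sup>2 - |z|\<^sup>2\<close> by \<open>|z\<^sup>\<beta>|\<^sup>2\<close> shows inductively that \<open>t - |z\<^sup>\<alpha>|\<^sup>2 \<in> C\<close> for some \<open>t\<close> whenever \<open>|\<alpha>| \<le> d\<close>, so
  the constant \<open>1\<close> is an order unit for \<open>C\<close>. Hence, if \<open>f - \<lambda> \<notin> C\<close>, then some linear functional is
  nonnegative on \<open>C\<close>, takes the value \<open>1\<close> at \<open>1\<close> and is at most \<open>\<lambda>\<close> at \<open>f\<close>; its moments are feasible,
  so \<open>\<rho>\<^sub>d \<le> \<lambda>\<close>. Thus \<open>\<rho>\<^sub>d \<le> \<rho>\<^sub>d\<^sup>*\<close>, and \<open>\<rho>\<^sub>d\<^sup>* > -\<infinity>\<close> because \<open>f + t \<in> C\<close> for large \<open>t\<close>. The converse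
  inequality applies the Riesz functional to a certificate, which is legitimate since a polynomial in
  \<open>z\<close> and its conjugate is determined by its values.
\<close>

section \<open>Polynomials in a vector and its conjugate as functions\<close>

lemma infinite_unit_circle: "infinite {w::complex. cmod w = 1}"
proof
  assume fin: "finite {w::complex. cmod w = 1}"
  \<comment> \<open>On a half turn the real part \<open>cos\<close> alone already separates the
    points.\<close>
  have "inj_on cis {0..pi}"
    by (rule inj_onI) (auto simp: cis.code intro: cos_inj_pi)
  moreover have "cis ` {0..pi} \<subseteq> {w. cmod w = 1}"
    by auto
  ultimately have "finite {0..pi}"
    using fin finite_subset inj_on_finite by blast
  then show False
    using infinite_Icc[OF pi_gt_zero] by simp
qed

lemma poly_sum_monom:
  fixes c :: "'i \<Rightarrow> 'a::comm_ring_1"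
  shows "poly (\<Sum>s\<in>S. monom (c s) (e s)) x = (\<Sum>s\<in>S. c s * x ^ e s)"
  by (simp add: poly_sum poly_monom)

text \<open>A univariate polynomial with infinitely many roots is zero, and the conclusion reads off
  its coefficient at \<open>N\<close>. Since \<open>e\<close> need not be injective, that
  coefficient collects every index with exponent \<open>N\<close>.\<close>

lemma sum_powers_zero_imp:
  fixes c :: "'i \<Rightarrow> 'a::idom"
  assumes inf: "infinite X" and zero: "\<And>x. x \<in> X \<Longrightarrow> (\<Sum>s\<in>S. c s * x ^ e s) = 0"
    and fin: "finite S"
  shows "(\<Sum>s\<in>{s\<in>S. e s = N}. c s) = 0"
proof -
  let ?q = "\<Sum>s\<in>S. monom (c s) (e s)"
  have "X \<subseteq> {x. poly ?q x = 0}"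
    using zero by (auto simp: poly_sum_monom)
  then have "infinite {x. poly ?q x = 0}"
    using inf finite_subset by blast
  then have "?q = 0"
    using poly_roots_finite by blast
  then have "0 = coeff ?q N"
    by simp
  also have "\<dots> = (\<Sum>s\<in>S. if e s = N then c s else 0)"
    by (simp add: coeff_sum)
  also have "\<dots> = (\<Sum>s\<in>{s\<in>S. e s = N}. c s)"
    using fin by (simp add: sum.inter_filter)
  finally show ?thesis by simp
qed

text \<open>In polar form \<open>z = r w\<close>, comparing powers of \<open>r\<close> fixes \<open>a + b\<close>, and then multiplying by
  \<open>w ^ (a + b)\<close> turns each monomial into \<open>w ^ (2 b)\<close>.\<close>

lemma conj_poly_zero_imp_coeff_zero:
  fixes c :: "nat \<times> nat \<Rightarrow> complex"
  assumes fin: "finite S"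
    and zero: "\<And>z. (\<Sum>s\<in>S. c s * (cnj z ^ fst s * z ^ snd s)) = 0"
    and s0: "s0 \<in> S"
  shows "c s0 = 0"
proof -
  let ?N = "fst s0 + snd s0"
  let ?T = "{s\<in>S. fst s + snd s = ?N}"
  have circle: "(\<Sum>s\<in>?T. c s * w ^ (2 * snd s)) = 0" if w: "cmod w = 1" for w
  proof -
    have "(\<Sum>s\<in>?T. c s * (cnj w ^ fst s * w ^ snd s)) = 0"
    proof (rule sum_powers_zero_imp[where X = "range complex_of_real" and e = "\<lambda>s. fst s + snd s"])
      show "infinite (range complex_of_real)"
        by (simp add: infinite_UNIV_char_0 finite_image_iff inj_on_def)
      fix x :: complex
      assume "x \<in> range complex_of_real"
      then obtain r where r: "x = of_real r" by auto
      show "(\<Sum>s\<in>S. c s * (cnj w ^ fst s * w ^ snd s) * x ^ (fst s + snd s)) = 0"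
        using zero[of "of_real r * w"] by (simp add: r power_mult_distrib power_add mult_ac)
    qed (use fin in auto)
    then have "0 = (\<Sum>s\<in>?T. c s * (cnj w ^ fst s * w ^ snd s)) * w ^ ?N"
      by simp
    also have "\<dots> = (\<Sum>s\<in>?T. c s * w ^ (2 * snd s))"
      unfolding sum_distrib_right
    proof (rule sum.cong)
      fix s assume "s \<in> ?T"
      then have N: "?N = fst s + snd s" by auto
      have "cnj w * w = 1"
        using w by (metis complex_norm_square mult.commute of_real_1 power_one)
      then have "cnj w ^ fst s * w ^ fst s = 1"
        by (metis power_mult_distrib power_one)
      moreover have "c s * (cnj w ^ fst s * w ^ snd s) * w ^ ?N
          = c s * (cnj w ^ fst s * w ^ fst s) * w ^ (2 * snd s)"
        unfolding N mult_2 power_add by (simp add: mult_ac)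
      ultimately show "c s * (cnj w ^ fst s * w ^ snd s) * w ^ ?N = c s * w ^ (2 * snd s)"
        by simp
    qed simp
    finally show ?thesis by simp
  qed
  have "(\<Sum>s\<in>{s\<in>?T. 2 * snd s = 2 * snd s0}. c s) = 0"
    by (rule sum_powers_zero_imp[OF infinite_unit_circle]) (use circle fin in auto)
  moreover have "{s\<in>?T. 2 * snd s = 2 * snd s0} = {s0}"
    using s0 by (auto simp: prod_eq_iff)
  ultimately show ?thesis by simp
qed

text \<open>Uniqueness of base \<open>B\<close> expansions: reduction modulo \<open>B\<close> gives
  the lowest digit, and cancelling it and a factor \<open>B\<close> leaves the remaining digits to
  the induction.\<close>

lemma digits_inject:
  fixes a b :: "nat \<Rightarrow> nat"
  assumes "\<And>j. j < N \<Longrightarrow> a j < B" "\<And>j. j < N \<Longrightarrow> b j < B"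
    and "(\<Sum>j<N. a j * B ^ j) = (\<Sum>j<N. b j * B ^ j)" and "j < N"
  shows "a j = b j"
  using assms
proof (induction N arbitrary: a b j)
  case (Suc N)
  have split: "(\<Sum>j<Suc N. x j * B ^ j) = x 0 + B * (\<Sum>j<N. x (Suc j) * B ^ j)" for x :: "nat \<Rightarrow> nat"
    unfolding sum.lessThan_Suc_shift by (simp add: sum_distrib_left mult_ac)
  have lt: "a 0 < B" "b 0 < B"
    using Suc.prems by auto
  have eq: "a 0 + B * (\<Sum>j<N. a (Suc j) * B ^ j) = b 0 + B * (\<Sum>j<N. b (Suc j) * B ^ j)"
    using Suc.prems(3) unfolding split .
  have "a 0 = b 0"
    using arg_cong[OF eq, of "\<lambda>x. x mod B"] lt by simp
  moreover have "a (Suc i) = b (Suc i)" if "i < N" for i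
    by (rule Suc.IH) (use Suc.prems eq lt \<open>a 0 = b 0\<close> that in auto)
  ultimately show ?case
    using Suc.prems(4) by (cases j) auto
qed simp

definition bmon :: "(nat ^ 'n) \<times> (nat ^ 'n) \<Rightarrow> complex ^ 'n \<Rightarrow> complex" where
  "bmon s z = mpow (vcnj z) (fst s) * mpow z (snd s)"

lemma mpow_vcnj: "mpow (vcnj z) \<alpha> = cnj (mpow z \<alpha>)"
  by (simp add: mpow_def vcnj_def)

lemma mpow_add: "mpow z (\<alpha> + \<beta>) = mpow z \<alpha> * mpow z \<beta>"
  by (simp add: mpow_def power_add prod.distrib)

lemma mpow_0 [simp]: "mpow z 0 = 1"
  by (simp add: mpow_def)

lemma bmon_0 [simp]: "bmon 0 z = 1"
  by (simp add: bmon_def)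

lemma bmon_add: "bmon (s + t) z = bmon s z * bmon t z"
  by (simp add: bmon_def mpow_add)

lemma cnj_bmon: "cnj (bmon (\<alpha>, \<beta>) z) = bmon (\<beta>, \<alpha>) z"
  by (simp add: bmon_def mpow_vcnj)

text \<open>Along the curve \<open>z\<^sub>j = \<zeta> ^ (B ^ j)\<close>, \<open>B\<close> larger than all exponents, distinct monomials
  restrict to distinct monomials in \<open>\<zeta>\<close> (Kronecker substitution).\<close>

lemma bmon_sum_zero_imp_coeff_zero:
  fixes c :: "(nat ^ 'n::finite) \<times> (nat ^ 'n) \<Rightarrow> complex"
  assumes fin: "finite S" and zero: "\<And>z. (\<Sum>s\<in>S. c s * bmon s z) = 0" and s0: "s0 \<in> S"
  shows "c s0 = 0"
proof -
  obtain e :: "'n \<Rightarrow> nat" where e: "bij_betw e UNIV {..<CARD('n)}"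
    using ex_bij_betw_finite_nat[of "UNIV :: 'n set"] by (auto simp: atLeast0LessThan)
  \<comment> \<open>The maximum of the sums bounds both exponents of each key, so every exponent
    occurring in \<open>S\<close> is a valid base \<open>B\<close> digit.\<close>
  define B where "B = Suc (Max ((\<lambda>(s, i). fst s $ i + snd s $ i) ` (S \<times> UNIV)))"
  have B: "fst s $ i < B" "snd s $ i < B" if "s \<in> S" for s i
  proof -
    have "fst s $ i + snd s $ i \<le> Max ((\<lambda>(s, i). fst s $ i + snd s $ i) ` (S \<times> UNIV))"
      by (rule Max_ge) (use fin that in auto)
    then show "fst s $ i < B" "snd s $ i < B"
      by (auto simp: B_def)
  qed
  \<comment> \<open>This is the exponent of the curve parameter in the restricted monomial: the
    entries of \<open>\<alpha>\<close> become base \<open>B\<close> digits, with positions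
    enumerated by \<open>e\<close>.\<close>
  define code where "code \<alpha> = (\<Sum>i\<in>UNIV. \<alpha> $ i * B ^ e i)" for \<alpha> :: "nat ^ 'n"
  have code: "code \<alpha> = (\<Sum>j<CARD('n). \<alpha> $ inv e j * B ^ j)" for \<alpha>
  proof -
    have "(\<Sum>i\<in>UNIV. \<alpha> $ inv e (e i) * B ^ e i) = (\<Sum>j<CARD('n). \<alpha> $ inv e j * B ^ j)"
      by (rule sum.reindex_bij_betw[OF e, of "\<lambda>j. \<alpha> $ inv e j * B ^ j"])
    moreover have "inv e (e i) = i" for i
      using e by (simp add: bij_betw_def)
    ultimately show ?thesis
      by (simp add: code_def)
  qed
  have code_inj: "\<alpha> = \<beta>" if eq: "code \<alpha> = code \<beta>" and lt: "\<And>i. \<alpha> $ i < B" "\<And>i. \<beta> $ i < B" for \<alpha> \<beta>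
  proof -
    have *: "\<alpha> $ inv e j = \<beta> $ inv e j" if "j < CARD('n)" for j
      by (rule digits_inject[OF _ _ eq[unfolded code] that]) (rule lt)+
    have "\<alpha> $ i = \<beta> $ i" for i
    proof -
      have "e i < CARD('n)" "inv e (e i) = i"
        using e by (auto simp: bij_betw_def)
      then show ?thesis using *[of "e i"] by simp
    qed
    then show ?thesis by (simp add: vec_eq_iff)
  qed
  define code2 where "code2 s = (code (fst s), code (snd s))" for s :: "(nat ^ 'n) \<times> (nat ^ 'n)"
  have inj: "inj_on code2 S"
    by (rule inj_onI) (auto simp: code2_def prod_eq_iff intro!: code_inj B)
  define curve :: "complex \<Rightarrow> complex ^ 'n" where "curve x = (\<chi> i. x ^ (B ^ e i))" for x
  have mpow_curve: "mpow (curve x) \<alpha> = x ^ code \<alpha>" for x \<alpha>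
    by (simp add: mpow_def curve_def code_def power_sum flip: power_mult) (simp add: mult.commute)
  \<comment> \<open>The coefficients are transported to pairs of codes. As \<open>code2\<close> is
    injective on \<open>S\<close>, no two terms merge and the case of one complex variable
    applies.\<close>
  have "c (inv_into S code2 (code2 s0)) = 0"
  proof (rule conj_poly_zero_imp_coeff_zero[where S = "code2 ` S"])
    fix x
    have "(\<Sum>t\<in>code2 ` S. c (inv_into S code2 t) * (cnj x ^ fst t * x ^ snd t))
        = (\<Sum>s\<in>S. c s * (cnj x ^ code (fst s) * x ^ code (snd s)))"
      by (simp add: sum.reindex[OF inj] inv_into_f_f[OF inj]) (simp add: code2_def)
    also have "\<dots> = (\<Sum>s\<in>S. c s * bmon s (curve x))"
      by (simp add: bmon_def mpow_vcnj mpow_curve)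
    finally show "(\<Sum>t\<in>code2 ` S. c (inv_into S code2 t) * (cnj x ^ fst t * x ^ snd t)) = 0"
      using zero by simp
  qed (use fin s0 in auto)
  then show ?thesis
    by (simp add: inv_into_f_f[OF inj s0])
qed

section \<open>Linear extension of a weight on keys, of which evaluation and the Riesz functional
  are both instances\<close>

definition pm_sum :: "('k \<Rightarrow> complex) \<Rightarrow> ('k \<Rightarrow>\<^sub>0 complex) \<Rightarrow> complex" where
  "pm_sum w \<phi> = (\<Sum>s\<in>Poly_Mapping.keys \<phi>. Poly_Mapping.lookup \<phi> s * w s)"

lemma pm_sum_superset:
  assumes "finite A" "Poly_Mapping.keys \<phi> \<subseteq> A"
  shows "pm_sum w \<phi> = (\<Sum>s\<in>A. Poly_Mapping.lookup \<phi> s * w s)"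
  unfolding pm_sum_def
  by (rule sum.mono_neutral_left) (use assms in \<open>auto simp: in_keys_iff\<close>)

lemma pm_sum_add: "pm_sum w (\<phi> + \<psi>) = pm_sum w \<phi> + pm_sum w \<psi>"
proof -
  let ?A = "Poly_Mapping.keys \<phi> \<union> Poly_Mapping.keys \<psi>"
  have "pm_sum w \<xi> = (\<Sum>s\<in>?A. Poly_Mapping.lookup \<xi> s * w s)" if "\<xi> \<in> {\<phi>, \<psi>, \<phi> + \<psi>}" for \<xi>
    by (rule pm_sum_superset) (use that keys_add[of \<phi> \<psi>] in auto)
  then show ?thesis
    by (simp add: lookup_add distrib_right sum.distrib)
qed

lemma pm_sum_uminus: "pm_sum w (- \<phi>) = - pm_sum w \<phi>"
  by (simp add: pm_sum_def Poly_Mapping.keys.rep_eq sum_negf)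

lemma pm_sum_diff: "pm_sum w (\<phi> - \<psi>) = pm_sum w \<phi> - pm_sum w \<psi>"
  using pm_sum_add[of w \<phi> "- \<psi>"] by (simp add: pm_sum_uminus)

lemma pm_sum_0 [simp]: "pm_sum w 0 = 0"
  by (simp add: pm_sum_def)

lemma pm_sum_single [simp]: "pm_sum w (Poly_Mapping.single s a) = a * w s"
  by (simp add: pm_sum_def)

lemma pm_sum_sum: "pm_sum w (\<Sum>i\<in>I. \<phi> i) = (\<Sum>i\<in>I. pm_sum w (\<phi> i))"
  by (induction I rule: infinite_finite_induct) (auto simp: pm_sum_add)

text \<open>Multiplication by a monomial is a shift of the weight. For evaluation the shift factors
  out as a value of the monomial; for moments it is the index shift in localizing matrices.\<close>

lemma pm_sum_single_times:
  fixes \<phi> :: "('k::monoid_add) \<Rightarrow>\<^sub>0 complex"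
  shows "pm_sum w (Poly_Mapping.single s a * \<phi>) = a * pm_sum (\<lambda>t. w (s + t)) \<phi>"
proof -
  have "\<phi> = (\<Sum>t\<in>Poly_Mapping.keys \<phi>. Poly_Mapping.single t (Poly_Mapping.lookup \<phi> t))"
    by (rule poly_mapping_eqI) (simp add: lookup_sum lookup_single when_def in_keys_iff)
  then have "pm_sum w (Poly_Mapping.single s a * \<phi>)
      = pm_sum w (\<Sum>t\<in>Poly_Mapping.keys \<phi>. Poly_Mapping.single (s + t) (a * Poly_Mapping.lookup \<phi> t))"
    by (metis (no_types, lifting) mult_single sum.cong sum_distrib_left)
  also have "\<dots> = a * pm_sum (\<lambda>t. w (s + t)) \<phi>"
    by (simp add: pm_sum_sum) (simp add: pm_sum_def sum_distrib_left mult_ac)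
  finally show ?thesis .
qed

lemma ceval_eq_pm_sum: "ceval \<phi> z = pm_sum (\<lambda>s. bmon s z) \<phi>"
  by (simp add: ceval_def pm_sum_def bmon_def case_prod_unfold mult.assoc)

lemma riesz_eq_pm_sum: "riesz y \<phi> = pm_sum (\<lambda>s. y (fst s) (snd s)) \<phi>"
  by (simp add: riesz_def pm_sum_def case_prod_unfold)

lemma loc_matrix_eq_riesz: "loc_matrix \<phi> y \<alpha> \<beta> = riesz y (Poly_Mapping.single (\<alpha>, \<beta>) 1 * \<phi>)"
  by (simp add: riesz_eq_pm_sum pm_sum_single_times)
     (simp add: loc_matrix_def pm_sum_def case_prod_unfold)

lemma ceval_single_times: "ceval (Poly_Mapping.single s a * \<phi>) z = a * bmon s z * ceval \<phi> z"
  by (simp add: ceval_eq_pm_sum pm_sum_single_times bmon_add)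
     (simp add: pm_sum_def sum_distrib_left mult_ac)

lemma ceval_1 [simp]: "ceval 1 z = 1"
  by (simp add: ceval_eq_pm_sum flip: single_one)

lemma ceval_eq_0_imp:
  assumes "\<And>z. ceval \<phi> z = 0"
  shows "\<phi> = 0"
proof (rule poly_mapping_eqI)
  fix s
  have "(\<Sum>s\<in>Poly_Mapping.keys \<phi>. Poly_Mapping.lookup \<phi> s * bmon s z) = 0" for z
    using assms[of z] by (simp add: ceval_eq_pm_sum pm_sum_def)
  then have "Poly_Mapping.lookup \<phi> s = 0" if "s \<in> Poly_Mapping.keys \<phi>"
    by (rule bmon_sum_zero_imp_coeff_zero[OF finite_keys _ that])
  then show "Poly_Mapping.lookup \<phi> s = Poly_Mapping.lookup 0 s"
    by (cases "s \<in> Poly_Mapping.keys \<phi>") (auto simp: in_keys_iff)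
qed

text \<open>Certificates are identities between functions, while the Riesz functional acts on
  coefficients; this is the passage from one to the other.\<close>

lemma ceval_inject:
  assumes "\<And>z. ceval \<phi> z = ceval \<psi> z"
  shows "\<phi> = \<psi>"
proof -
  have "ceval (\<phi> - \<psi>) z = 0" for z
    using assms[of z] by (simp add: ceval_eq_pm_sum pm_sum_diff)
  then have "\<phi> - \<psi> = 0" by (rule ceval_eq_0_imp)
  then show ?thesis by simp
qed

section \<open>Positive functionals on cones with an order unit\<close>

text \<open>Enlarge the cone to a maximal one \<open>M\<close> missing \<open>x\<close>; then \<open>M \<union> - M\<close> is everything, and the
  functional sends \<open>v\<close> to the cut \<open>l\<close> at which \<open>v - s e\<close> passes from \<open>M\<close> to \<open>- M\<close>.\<close>

lemma cone_separation:
  fixes C V :: "('a \<Rightarrow> real) set"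
  assumes C_add: "\<And>u v. u \<in> C \<Longrightarrow> v \<in> C \<Longrightarrow> (\<lambda>z. u z + v z) \<in> C"
    and C_scale: "\<And>c v. 0 \<le> c \<Longrightarrow> v \<in> C \<Longrightarrow> (\<lambda>z. c * v z) \<in> C"
    and e: "e \<in> C"
    and V_scale: "\<And>c v. v \<in> V \<Longrightarrow> (\<lambda>z. c * v z) \<in> V"
    and V_add: "\<And>u v. u \<in> V \<Longrightarrow> v \<in> V \<Longrightarrow> (\<lambda>z. u z + v z) \<in> V"
    and unit: "\<And>v. v \<in> V \<Longrightarrow> \<exists>t. (\<lambda>z. v z + t * e z) \<in> C"
    and x: "x \<in> V" "x \<notin> C"
  obtains L where "\<forall>u\<in>V. \<forall>v\<in>V. L (\<lambda>z. u z + v z) = L u + L v"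
    and "\<forall>v\<in>V. \<forall>c. L (\<lambda>z. c * v z) = c * L v"
    and "\<forall>v\<in>V. v \<in> C \<longrightarrow> 0 \<le> L v"
    and "L e = (1::real)" and "L x \<le> 0"
proof -
  \<comment> \<open>The convex cones of functions that contain \<open>C\<close> and miss
    \<open>x\<close>, ordered by inclusion for Zorn's lemma.\<close>
  define A where "A = {M. C \<subseteq> M \<and> x \<notin> M \<and> (\<forall>u\<in>M. \<forall>v\<in>M. (\<lambda>z. u z + v z) \<in> M) \<and>
    (\<forall>c\<ge>0. \<forall>v\<in>M. (\<lambda>z. c * v z) \<in> M)}"
  have A_I: "M \<in> A" if "C \<subseteq> M" "x \<notin> M" "\<And>u v. u \<in> M \<Longrightarrow> v \<in> M \<Longrightarrow> (\<lambda>z. u z + v z) \<in> M"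
    "\<And>c v. 0 \<le> c \<Longrightarrow> v \<in> M \<Longrightarrow> (\<lambda>z. c * v z) \<in> M" for M
    unfolding A_def mem_Collect_eq by (intro conjI ballI allI impI that)
  have A_D: "C \<subseteq> M" "x \<notin> M" if "M \<in> A" for M
    using that unfolding A_def by blast+
  have A_add: "(\<lambda>z. u z + v z) \<in> M" if "M \<in> A" "u \<in> M" "v \<in> M" for M u v
    using that(1) that(2,3) unfolding A_def mem_Collect_eq by (elim conjE) (drule (1) bspec)+
  have A_scale: "(\<lambda>z. c * v z) \<in> M" if "M \<in> A" "0 \<le> c" "v \<in> M" for M c v
  proof -
    have "\<forall>c\<ge>0. \<forall>v\<in>M. (\<lambda>z. c * v z) \<in> M"
      using that(1) unfolding A_def mem_Collect_eq by (elim conjE)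
    then show ?thesis
      using that(2,3) by (elim allE[of _ c] impE ballE[of _ _ v]) auto
  qed
  have "\<exists>M\<in>A. \<forall>X\<in>A. M \<subseteq> X \<longrightarrow> X = M"
  proof (rule subset_Zorn_nonempty)
    show "A \<noteq> {}"
      using A_I[of C] C_add C_scale x(2) by blast
  next
    fix Ch assume ne: "Ch \<noteq> {}" and ch: "subset.chain A Ch"
    have sub: "Ch \<subseteq> A" and lin: "\<And>X Y. X \<in> Ch \<Longrightarrow> Y \<in> Ch \<Longrightarrow> X \<subseteq> Y \<or> Y \<subseteq> X"
      using ch by (auto simp: subset.chain_def)
    have "(\<lambda>z. u z + v z) \<in> \<Union>Ch" if "u \<in> \<Union>Ch" "v \<in> \<Union>Ch" for u v
    proof -
      obtain X Y where XY: "X \<in> Ch" "u \<in> X" "Y \<in> Ch" "v \<in> Y" using \<open>u \<in> \<Union>Ch\<close> \<open>v \<in> \<Union>Ch\<close> by auto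
      \<comment> \<open>Of two members of a chain the larger one contains both functions.\<close>
      then obtain Z where "Z \<in> Ch" "u \<in> Z" "v \<in> Z" using lin[of X Y] by auto
      then have "(\<lambda>z. u z + v z) \<in> Z"
        using sub by (intro A_add) auto
      then show ?thesis using \<open>Z \<in> Ch\<close> by (rule UnionI[rotated])
    qed
    moreover have "(\<lambda>z. c * v z) \<in> \<Union>Ch" if "c \<ge> 0" "v \<in> \<Union>Ch" for c v
    proof -
      obtain X where X: "X \<in> Ch" "v \<in> X" using \<open>v \<in> \<Union>Ch\<close> by auto
      then have "(\<lambda>z. c * v z) \<in> X"
        using sub \<open>c \<ge> 0\<close> by (intro A_scale) auto
      then show ?thesis using X(1) by (rule UnionI[rotated])
    qed
    moreover have "C \<subseteq> \<Union>Ch" "x \<notin> \<Union>Ch"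
      using ne sub A_D by blast+
    ultimately show "\<Union>Ch \<in> A"
      by (intro A_I)
  qed
  then obtain M where M: "M \<in> A" and M_max: "\<And>X. X \<in> A \<Longrightarrow> M \<subseteq> X \<Longrightarrow> X = M"
    by blast
  have CM: "C \<subseteq> M" and xM: "x \<notin> M"
    and M_add: "\<And>u v. u \<in> M \<Longrightarrow> v \<in> M \<Longrightarrow> (\<lambda>z. u z + v z) \<in> M"
    and M_scale: "\<And>c v. 0 \<le> c \<Longrightarrow> v \<in> M \<Longrightarrow> (\<lambda>z. c * v z) \<in> M"
    using A_D[OF M] A_add[OF M] A_scale[OF M] by auto
  have eM: "e \<in> M" using e CM by auto
  have zeroM: "(\<lambda>z. 0) \<in> M"
    using M_scale[of 0 e] eM by simp
  \<comment> \<open>By maximality the cone generated by \<open>M\<close> and \<open>v\<close> must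
    contain \<open>x\<close>; the weight of \<open>v\<close> is positive because \<open>x\<close> is
    not in \<open>M\<close>.\<close>
  have reach: "\<exists>t>0. \<exists>w\<in>M. x = (\<lambda>z. w z + t * v z)" if "v \<notin> M" for v
  proof (rule ccontr)
    assume contra: "\<not> ?thesis"
    define X where "X = {u. \<exists>t\<ge>0. \<exists>w\<in>M. u = (\<lambda>z. w z + t * v z)}"
    have X_I: "(\<lambda>z. w z + t * v z) \<in> X" if "0 \<le> t" "w \<in> M" for t w
      unfolding X_def using that by blast
    have "M \<subseteq> X"
    proof
      fix w assume "w \<in> M"
      moreover have "w = (\<lambda>z. w z + 0 * v z)" by simp
      ultimately show "w \<in> X" unfolding X_def by blast
    qed
    have "X \<in> A"
    proof (rule A_I)
      show "C \<subseteq> X" using CM \<open>M \<subseteq> X\<close> by auto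
      show "x \<notin> X"
      proof
        assume "x \<in> X"
        then obtain t w where tw: "t \<ge> 0" "w \<in> M" "x = (\<lambda>z. w z + t * v z)"
          by (auto simp: X_def)
        then have "t \<noteq> 0" using xM by auto
        then have "t > 0" using tw(1) by simp
        with contra tw(2,3) show False by blast
      qed
    next
      fix u u' assume "u \<in> X" "u' \<in> X"
      then obtain t w t' w' where *: "t \<ge> 0" "w \<in> M" "u = (\<lambda>z. w z + t * v z)"
        "t' \<ge> 0" "w' \<in> M" "u' = (\<lambda>z. w' z + t' * v z)"
        by (auto simp: X_def)
      have "(\<lambda>z. u z + u' z) = (\<lambda>z. (w z + w' z) + (t + t') * v z)"
        using * by (auto simp: algebra_simps)
      then show "(\<lambda>z. u z + u' z) \<in> X"
        using X_I[of "t + t'" "\<lambda>z. w z + w' z"] M_add[of w w'] * by simp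
    next
      fix c :: real and u assume "c \<ge> 0" "u \<in> X"
      then obtain t w where *: "t \<ge> 0" "w \<in> M" "u = (\<lambda>z. w z + t * v z)"
        by (auto simp: X_def)
      have "(\<lambda>z. c * u z) = (\<lambda>z. c * w z + (c * t) * v z)"
        using * by (auto simp: algebra_simps)
      then show "(\<lambda>z. c * u z) \<in> X"
        using X_I[of "c * t" "\<lambda>z. c * w z"] M_scale[of c w] * \<open>c \<ge> 0\<close> by simp
    qed
    then have "X = M" using M_max \<open>M \<subseteq> X\<close> by blast
    moreover have "v \<in> X"
      using X_I[of 1, OF _ zeroM] by simp
    ultimately show False using \<open>v \<notin> M\<close> by blast
  qed
  have total: "v \<in> M \<or> (\<lambda>z. - v z) \<in> M" for v
  proof (rule ccontr)
    assume "\<not> ?thesis"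
    then obtain t w t' w' where t: "t > 0" "w \<in> M" "x = (\<lambda>z. w z + t * v z)"
      and t': "t' > 0" "w' \<in> M" "x = (\<lambda>z. w' z + t' * - v z)"
      using reach by metis
    \<comment> \<open>The weights are chosen to cancel \<open>v\<close> between the two
      representations of \<open>x\<close>, which makes \<open>x\<close> a convex combination of
      elements of \<open>M\<close>.\<close>
    have "x z = (t' / (t + t')) * w z + (t / (t + t')) * w' z" for z
    proof -
      have "(t + t') * x z = t' * w z + t * w' z"
        using fun_cong[OF t(3), of z] fun_cong[OF t'(3), of z]
        by algebra
      then have "x z = (t' * w z + t * w' z) / (t + t')"
        using t(1) t'(1) by (simp add: eq_divide_eq mult.commute)
      then show ?thesis by (simp add: add_divide_distrib)
    qed
    then have "x = (\<lambda>z. (t' / (t + t')) * w z + (t / (t + t')) * w' z)" by auto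
    moreover have "\<dots> \<in> M"
      using t t' by (intro M_add M_scale) auto
    ultimately show False using xM by simp
  qed
  \<comment> \<open>Otherwise \<open>M\<close> would contain all real multiples of \<open>e\<close>,
    and the order unit property would put \<open>x\<close> itself into \<open>M\<close>.\<close>
  have neg_e: "(\<lambda>z. - e z) \<notin> M"
  proof
    assume ne: "(\<lambda>z. - e z) \<in> M"
    obtain t where t: "(\<lambda>z. x z + t * e z) \<in> M"
      using unit[OF x(1)] CM by auto
    have "(\<lambda>z. \<bar>t\<bar> * e z) \<in> M" "(\<lambda>z. \<bar>t\<bar> * - e z) \<in> M"
      using M_scale[OF abs_ge_zero eM] M_scale[OF abs_ge_zero ne] by auto
    then have "(\<lambda>z. - t * e z) \<in> M"
      by (cases "t \<ge> 0") auto
    from M_add[OF t this] show False using xM by simp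
  qed
  have neg_se: "(\<lambda>z. - s * e z) \<notin> M" if "s > 0" for s
  proof
    assume "(\<lambda>z. - s * e z) \<in> M"
    from M_scale[OF _ this, of "1 / s"] show False
      using neg_e that by simp
  qed
  \<comment> \<open>The cut is a relation with strict inequalities, so nothing is claimed at
    \<open>s = l\<close>. Its algebraic laws hold for arbitrary functions and pass to
    \<open>L\<close> by uniqueness.\<close>
  define Q where "Q v l \<longleftrightarrow> (\<forall>s<l. (\<lambda>z. v z - s * e z) \<in> M) \<and> (\<forall>s>l. (\<lambda>z. s * e z - v z) \<in> M)" for v l
  have Q_unique: "l = l'" if Q: "Q v l" "Q v l'" for v l l'
  proof -
    have False if ll: "l < l'" and Q: "Q v l" "Q v l'" for l l'
    proof -
      \<comment> \<open>Two points strictly between the supposed cuts: below the larger cut and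
        above the smaller one, they force a negative multiple of \<open>e\<close> into
        \<open>M\<close>.\<close>
      define s where "s = l + (l' - l) / 3"
      define s' where "s' = l + 2 * (l' - l) / 3"
      have "l < s" "s < s'" "s' < l'"
        using ll by (auto simp: s_def s'_def field_simps)
      then have "(\<lambda>z. s * e z - v z) \<in> M" "(\<lambda>z. v z - s' * e z) \<in> M"
        using Q by (auto simp: Q_def)
      from M_add[OF this] have "(\<lambda>z. - (s' - s) * e z) \<in> M"
        by (simp add: algebra_simps)
      then show False using neg_se[of "s' - s"] \<open>s < s'\<close> by simp
    qed
    then show ?thesis using Q by (meson linorder_neqE_linordered_idom)
  qed
  have Q_exists: "\<exists>l. Q v l" if v: "v \<in> V" for v
  proof -
    define S where "S = {s. (\<lambda>z. v z - s * e z) \<in> M}"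
    obtain t where t: "(\<lambda>z. v z + t * e z) \<in> M" using unit[OF v] CM by auto
    \<comment> \<open>The order unit is used twice: for \<open>v\<close> it makes \<open>S\<close>
      nonempty, and for \<open>- v\<close> it bounds \<open>S\<close> above.\<close>
    obtain t' where "(\<lambda>z. (-1) * v z + t' * e z) \<in> C" using unit[OF V_scale[OF v]] by blast
    then have t': "(\<lambda>z. (-1) * v z + t' * e z) \<in> M" using CM by auto
    have down: "s' \<in> S" if "s \<in> S" "s' \<le> s" for s s'
    proof -
      have "(\<lambda>z. (v z - s * e z) + (s - s') * e z) \<in> M"
        using that by (intro M_add M_scale eM) (auto simp: S_def)
      then show ?thesis by (simp add: S_def algebra_simps)
    qed
    have ne: "- t \<in> S" using t by (simp add: S_def)
    have bound: "s \<le> t'" if "s \<in> S" for s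
    proof (rule ccontr)
      assume "\<not> s \<le> t'"
      moreover from that have "(\<lambda>z. v z - s * e z) \<in> M" by (simp add: S_def)
      from M_add[OF this t'] have "(\<lambda>z. - (s - t') * e z) \<in> M" by (simp add: algebra_simps)
      ultimately show False using neg_se[of "s - t'"] by simp
    qed
    have bdd: "bdd_above S" using bound by (auto simp: bdd_above_def)
    have "Q v (Sup S)"
      unfolding Q_def
    proof (intro conjI allI impI)
      fix s assume "s < Sup S"
      then obtain s' where "s' \<in> S" "s < s'"
        using less_cSup_iff[of S s] ne bdd by auto
      then have "s \<in> S" using down by auto
      then show "(\<lambda>z. v z - s * e z) \<in> M" by (simp add: S_def)
    next
      fix s assume "Sup S < s"
      then have "s \<notin> S" using cSup_upper[OF _ bdd] by force
      then show "(\<lambda>z. s * e z - v z) \<in> M"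
        using total[of "\<lambda>z. v z - s * e z"] by (simp add: S_def)
    qed
    then show ?thesis ..
  qed
  define L where "L v = (THE l. Q v l)" for v
  have L_eq: "L v = l" if "Q v l" for v l
    unfolding L_def using that Q_unique by blast
  have L: "Q v (L v)" if "v \<in> V" for v
    using Q_exists[OF that] L_eq by metis
  have pos: "0 \<le> l" if "Q v l" "v \<in> M" for v l
  proof (rule ccontr)
    assume "\<not> 0 \<le> l"
    \<comment> \<open>For negative \<open>l\<close> the value \<open>l / 2\<close> lies above the
      cut but is still negative, so adding \<open>v\<close> leaves a negative multiple of
      \<open>e\<close> in \<open>M\<close>.\<close>
    then have "l < l / 2" by simp
    with \<open>Q v l\<close> have "(\<lambda>z. (l / 2) * e z - v z) \<in> M"
      unfolding Q_def by blast
    from M_add[OF this \<open>v \<in> M\<close>] show False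
      using neg_se[of "- l / 2"] \<open>\<not> 0 \<le> l\<close> by simp
  qed
  have Q_add: "Q (\<lambda>z. u z + v z) (l + l')" if "Q u l" "Q v l'" for u v l l'
    unfolding Q_def
  proof (intro conjI allI impI)
    fix s assume s: "s < l + l'"
    \<comment> \<open>Half of the slack goes to each summand, which keeps both shifts strictly below
      their cuts.\<close>
    define d where "d = (l + l' - s) / 2"
    have "d > 0" "s = (l - d) + (l' - d)"
      using s by (auto simp: d_def field_simps)
    then have "(\<lambda>z. u z - (l - d) * e z) \<in> M" "(\<lambda>z. v z - (l' - d) * e z) \<in> M"
      using that by (auto simp: Q_def)
    from M_add[OF this] show "(\<lambda>z. (u z + v z) - s * e z) \<in> M"
      unfolding \<open>s = (l - d) + (l' - d)\<close> by (simp add: algebra_simps)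
  next
    fix s assume s: "s > l + l'"
    define d where "d = (s - (l + l')) / 2"
    have "d > 0" "s = (l + d) + (l' + d)"
      using s by (auto simp: d_def field_simps)
    then have "(\<lambda>z. (l + d) * e z - u z) \<in> M" "(\<lambda>z. (l' + d) * e z - v z) \<in> M"
      using that by (auto simp: Q_def)
    from M_add[OF this] show "(\<lambda>z. s * e z - (u z + v z)) \<in> M"
      unfolding \<open>s = (l + d) + (l' + d)\<close> by (simp add: algebra_simps)
  qed
  have Q_pos: "Q (\<lambda>z. c * v z) (c * l)" if "Q v l" "c > 0" for c v l
    unfolding Q_def
  proof (intro conjI allI impI)
    fix s assume "s < c * l"
    then have "s / c < l" using \<open>c > 0\<close> by (simp add: field_simps)
    then have "(\<lambda>z. v z - s / c * e z) \<in> M"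
      using that by (auto simp: Q_def)
    from M_scale[OF _ this, of c] show "(\<lambda>z. c * v z - s * e z) \<in> M"
      using \<open>c > 0\<close> by (simp add: algebra_simps)
  next
    fix s assume "s > c * l"
    then have "s / c > l" using \<open>c > 0\<close> by (simp add: field_simps)
    then have "(\<lambda>z. s / c * e z - v z) \<in> M"
      using that by (auto simp: Q_def)
    from M_scale[OF _ this, of c] show "(\<lambda>z. s * e z - c * v z) \<in> M"
      using \<open>c > 0\<close> by (simp add: algebra_simps)
  qed
  have Q_neg: "Q (\<lambda>z. - v z) (- l)" if "Q v l" for v l
    unfolding Q_def
  proof (intro conjI allI impI)
    fix s assume "s < - l"
    then have "(\<lambda>z. (- s) * e z - v z) \<in> M"
      using that unfolding Q_def by (metis less_minus_iff)
    moreover have "(\<lambda>z. - v z - s * e z) = (\<lambda>z. (- s) * e z - v z)" by auto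
    ultimately show "(\<lambda>z. - v z - s * e z) \<in> M" by simp
  next
    fix s assume "- l < s"
    then have "(\<lambda>z. v z - (- s) * e z) \<in> M"
      using that unfolding Q_def by (metis minus_less_iff)
    moreover have "(\<lambda>z. s * e z - - v z) = (\<lambda>z. v z - (- s) * e z)" by auto
    ultimately show "(\<lambda>z. s * e z - - v z) \<in> M" by simp
  qed
  have Q_0: "Q (\<lambda>z. 0) 0"
    unfolding Q_def
  proof (intro conjI allI impI)
    fix s :: real assume "s < 0"
    then show "(\<lambda>z. 0 - s * e z) \<in> M"
      using M_scale[OF _ eM, of "- s"] by simp
  next
    fix s :: real assume "0 < s"
    then show "(\<lambda>z. s * e z - 0) \<in> M"
      using M_scale[OF _ eM, of s] by simp
  qed
  have Q_scale: "Q (\<lambda>z. c * v z) (c * l)" if "Q v l" for c v l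
  proof -
    consider "c > 0" | "c = 0" | "c < 0" by linarith
    then show ?thesis
    proof cases
      case 3
      then show ?thesis
        using Q_neg[OF Q_pos[OF that, of "- c"]] by simp
    qed (use Q_pos[OF that] Q_0 in auto)
  qed
  show ?thesis
  proof (rule that[of L]; (intro ballI allI impI)?)
    show "L (\<lambda>z. u z + v z) = L u + L v" if "u \<in> V" "v \<in> V" for u v
      by (rule L_eq) (intro Q_add L that)
    show "L (\<lambda>z. c * v z) = c * L v" if "v \<in> V" for c v
      by (rule L_eq) (intro Q_scale L that)
    show "0 \<le> L v" if "v \<in> V" "v \<in> C" for v
      using pos[OF L[OF that(1)]] CM that by auto
    show "L e = 1"
    proof (rule L_eq, unfold Q_def, intro conjI allI impI)
      fix s :: real assume "s < 1"
      then show "(\<lambda>z. e z - s * e z) \<in> M"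
        using M_scale[OF _ eM, of "1 - s"] by (simp add: algebra_simps)
    next
      fix s :: real assume "1 < s"
      then show "(\<lambda>z. s * e z - e z) \<in> M"
        using M_scale[OF _ eM, of "s - 1"] by (simp add: algebra_simps)
    qed
    show "L x \<le> 0"
    proof (rule ccontr)
      assume "\<not> L x \<le> 0"
      \<comment> \<open>If \<open>L x\<close> were positive, then \<open>0\<close> would lie below
        the cut of \<open>x\<close>.\<close>
      then have "(\<lambda>z. x z - 0 * e z) \<in> M"
        using L[OF x(1)] unfolding Q_def by (meson not_le)
      then show False using xM by simp
    qed
  qed
qed

section \<open>Sums of squares and localizing matrices\<close>

lemma mi_deg_add: "mi_deg (\<alpha> + \<beta>) = mi_deg \<alpha> + mi_deg \<beta>"
  by (simp add: mi_deg_def sum.distrib)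

lemma mi_deg_0 [simp]: "mi_deg 0 = 0"
  by (simp add: mi_deg_def)

lemma mi_deg_axis [simp]: "mi_deg (axis j a) = a"
  by (simp add: mi_deg_def axis_def)

lemma mi_le_iff: "\<alpha> \<in> mi_le d \<longleftrightarrow> mi_deg \<alpha> \<le> d"
  by (simp add: mi_le_def)

lemma mi_le_add: "\<alpha> \<in> mi_le d \<Longrightarrow> \<beta> \<in> mi_le e \<Longrightarrow> \<alpha> + \<beta> \<in> mi_le (d + e)"
  by (simp add: mi_le_iff mi_deg_add)

lemma finite_mi_le [simp]: "finite (mi_le d :: (nat ^ 'n::finite) set)"
proof (rule inj_on_finite[where f = vec_nth])
  show "inj_on vec_nth (mi_le d :: (nat ^ 'n) set)"
    by (simp add: inj_on_def vec_nth_inject)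
  show "vec_nth ` (mi_le d :: (nat ^ 'n) set) \<subseteq> PiE UNIV (\<lambda>_. {..d})"
  proof clarify
    fix \<alpha> :: "nat ^ 'n" assume "\<alpha> \<in> mi_le d"
    moreover have "\<alpha> $ i \<le> mi_deg \<alpha>" for i
      unfolding mi_deg_def by (rule member_le_sum) auto
    ultimately show "vec_nth \<alpha> \<in> PiE UNIV (\<lambda>_. {..d})"
      by (auto simp: mi_le_iff intro: order_trans)
  qed
  show "finite (PiE (UNIV :: 'n set) (\<lambda>_. {..d}))"
    by (rule finite_PiE) auto
qed

lemma mpow_axis: "mpow z (axis j (Suc 0)) = z $ j"
proof -
  have "mpow z (axis j (Suc 0)) = (\<Prod>i\<in>UNIV. if i = j then z $ i else 1)"
    unfolding mpow_def by (rule prod.cong) (auto simp: axis_def)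
  then show ?thesis by simp
qed

lemma hol_poly_monom:
  assumes "\<alpha> \<in> mi_le d"
  shows "(\<lambda>z. c * mpow z \<alpha>) \<in> hol_poly_le d"
proof -
  have "(\<Sum>\<beta>\<in>mi_le d. (if \<beta> = \<alpha> then c else 0) * mpow z \<beta>) = c * mpow z \<alpha>" for z
    using assms by (simp add: if_distrib[of "\<lambda>x. x * _"] cong: if_cong)
  then show ?thesis
    unfolding hol_poly_le_def mem_Collect_eq by (intro exI[of _ "\<lambda>\<beta>. if \<beta> = \<alpha> then c else 0"]) simp
qed

lemma hol_poly_add:
  assumes "p \<in> hol_poly_le d" "q \<in> hol_poly_le d"
  shows "(\<lambda>z. p z + q z) \<in> hol_poly_le d"
proof -
  obtain a b where "p = (\<lambda>z. \<Sum>\<alpha>\<in>mi_le d. a \<alpha> * mpow z \<alpha>)" "q = (\<lambda>z. \<Sum>\<alpha>\<in>mi_le d. b \<alpha> * mpow z \<alpha>)"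
    using assms by (auto simp: hol_poly_le_def)
  then have "(\<lambda>z. p z + q z) = (\<lambda>z. \<Sum>\<alpha>\<in>mi_le d. (a \<alpha> + b \<alpha>) * mpow z \<alpha>)"
    by (simp add: sum.distrib distrib_right)
  then show ?thesis
    unfolding hol_poly_le_def mem_Collect_eq by (intro exI[of _ "\<lambda>\<alpha>. a \<alpha> + b \<alpha>"])
qed

lemma hol_poly_scale:
  assumes "p \<in> hol_poly_le d"
  shows "(\<lambda>z. c * p z) \<in> hol_poly_le d"
proof -
  obtain a where "p = (\<lambda>z. \<Sum>\<alpha>\<in>mi_le d. a \<alpha> * mpow z \<alpha>)"
    using assms by (auto simp: hol_poly_le_def)
  then have "(\<lambda>z. c * p z) = (\<lambda>z. \<Sum>\<alpha>\<in>mi_le d. (c * a \<alpha>) * mpow z \<alpha>)"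
    by (simp add: sum_distrib_left mult.assoc)
  then show ?thesis
    unfolding hol_poly_le_def mem_Collect_eq by (intro exI[of _ "\<lambda>\<alpha>. c * a \<alpha>"])
qed

lemma hsosI:
  "1 \<le> (r::nat) \<Longrightarrow> (\<And>j. j \<in> {1..r} \<Longrightarrow> p j \<in> hol_poly_le d) \<Longrightarrow>
   (\<lambda>z. \<Sum>j=1..r. (cmod (p j z))\<^sup>2) \<in> hsos d"
  unfolding hsos_def mem_Collect_eq by (intro exI[of _ r] exI[of _ p]) simp

lemma hsosE:
  assumes "\<sigma> \<in> hsos d"
  obtains r :: nat and p where "1 \<le> r" "\<forall>j\<in>{1..r}. p j \<in> hol_poly_le d"
    "\<sigma> = (\<lambda>z. \<Sum>j=1..r. (cmod (p j z))\<^sup>2)"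
  using assms unfolding hsos_def mem_Collect_eq
  by (elim exE conjE) (rule that)

lemma hsos_norm_square:
  "p \<in> hol_poly_le d \<Longrightarrow> (\<lambda>z. (cmod (p z))\<^sup>2) \<in> hsos d"
  using hsosI[of 1 "\<lambda>_. p"] by simp

lemma hsos_scale:
  assumes "0 \<le> c" "\<sigma> \<in> hsos d"
  shows "(\<lambda>z. c * \<sigma> z) \<in> hsos d"
proof -
  obtain r :: nat and p where r: "1 \<le> r" and p: "\<forall>j\<in>{1..r}. p j \<in> hol_poly_le d"
    and \<sigma>: "\<sigma> = (\<lambda>z. \<Sum>j=1..r. (cmod (p j z))\<^sup>2)"
    using assms(2) by (rule hsosE)
  have "(\<lambda>z. c * \<sigma> z) = (\<lambda>z. \<Sum>j=1..r. (cmod (of_real (sqrt c) * p j z))\<^sup>2)"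
    using assms(1) by (simp add: \<sigma> sum_distrib_left norm_mult power_mult_distrib)
  also have "\<dots> \<in> hsos d"
    using r p by (intro hsosI hol_poly_scale) simp_all
  finally show ?thesis .
qed

lemma hsos_add:
  assumes "\<sigma> \<in> hsos d" "\<tau> \<in> hsos d"
  shows "(\<lambda>z. \<sigma> z + \<tau> z) \<in> hsos d"
proof -
  obtain r :: nat and p where r: "1 \<le> r" and p: "\<forall>j\<in>{1..r}. p j \<in> hol_poly_le d"
    and \<sigma>: "\<sigma> = (\<lambda>z. \<Sum>j=1..r. (cmod (p j z))\<^sup>2)"
    using assms(1) by (rule hsosE)
  obtain s :: nat and q where s: "1 \<le> s" and q: "\<forall>j\<in>{1..s}. q j \<in> hol_poly_le d"
    and \<tau>: "\<tau> = (\<lambda>z. \<Sum>j=1..s. (cmod (q j z))\<^sup>2)"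
    using assms(2) by (rule hsosE)
  \<comment> \<open>Concatenation of the two lists of squares, the second one shifted by
    \<open>r\<close>.\<close>
  define w where "w j = (if j \<le> r then p j else q (j - r))" for j
  have "(\<Sum>j=1..r + s. (cmod (w j z))\<^sup>2) = \<sigma> z + \<tau> z" for z
  proof -
    have "(\<Sum>j=1..r + s. (cmod (w j z))\<^sup>2)
        = (\<Sum>j=1..r. (cmod (w j z))\<^sup>2) + (\<Sum>j=r + 1..r + s. (cmod (w j z))\<^sup>2)"
      using r by (subst sum.ub_add_nat) auto
    also have "(\<Sum>j=r + 1..r + s. (cmod (w j z))\<^sup>2) = (\<Sum>j=1..s. (cmod (w (j + r) z))\<^sup>2)"
      using sum.shift_bounds_cl_nat_ivl[where g = "\<lambda>j. (cmod (w j z))\<^sup>2" and m = 1 and k = r and n = s] by (simp add: add.commute)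
    finally show ?thesis
      by (simp add: w_def \<sigma> \<tau>)
  qed
  then have "(\<lambda>z. \<sigma> z + \<tau> z) = (\<lambda>z. \<Sum>j=1..r + s. (cmod (w j z))\<^sup>2)"
    by simp
  also have "\<dots> \<in> hsos d"
  proof (rule hsosI)
    fix j assume j: "j \<in> {1..r + s}"
    show "w j \<in> hol_poly_le d"
    proof (cases "j \<le> r")
      case True
      then show ?thesis using j p by (simp add: w_def)
    next
      case False
      then have "j - r \<in> {1..s}" using j by auto
      then show ?thesis using False q by (simp add: w_def)
    qed
  qed (use r in simp)
  finally show ?thesis .
qed

text \<open>A sum of squares has at least one term here, so zero is obtained by scaling one square
  by \<open>0\<close>.\<close>

lemma hsos_0: "(\<lambda>z. 0) \<in> hsos d"
  using hsos_scale[of 0, OF _ hsos_norm_square[OF hol_poly_monom[of 0 d 1]]] by (simp add: mi_le_iff)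

text \<open>The coefficient family of the squared modulus of the holomorphic polynomial with
  coefficients \<open>c\<close>.\<close>

definition gram :: "nat \<Rightarrow> (nat ^ 'n \<Rightarrow> complex) \<Rightarrow> ('n::finite) cpoly" where
  "gram e c = (\<Sum>\<alpha>\<in>mi_le e. \<Sum>\<beta>\<in>mi_le e. Poly_Mapping.single (\<alpha>, \<beta>) (cnj (c \<alpha>) * c \<beta>))"

lemma ceval_gram_times:
  "ceval (gram e c * \<phi>) z = of_real ((cmod (\<Sum>\<alpha>\<in>mi_le e. c \<alpha> * mpow z \<alpha>))\<^sup>2) * ceval \<phi> z"
proof -
  have "ceval (gram e c * \<phi>) z
      = (\<Sum>\<alpha>\<in>mi_le e. \<Sum>\<beta>\<in>mi_le e. ceval (Poly_Mapping.single (\<alpha>, \<beta>) (cnj (c \<alpha>) * c \<beta>) * \<phi>) z)"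
    by (simp add: gram_def sum_distrib_right ceval_eq_pm_sum pm_sum_sum)
  also have "\<dots> = (\<Sum>\<alpha>\<in>mi_le e. \<Sum>\<beta>\<in>mi_le e. cnj (c \<alpha> * mpow z \<alpha>) * (c \<beta> * mpow z \<beta>)) * ceval \<phi> z"
    unfolding ceval_single_times sum_distrib_right by (simp add: bmon_def mpow_vcnj mult_ac)
  also have "(\<Sum>\<alpha>\<in>mi_le e. \<Sum>\<beta>\<in>mi_le e. cnj (c \<alpha> * mpow z \<alpha>) * (c \<beta> * mpow z \<beta>))
      = cnj (\<Sum>\<alpha>\<in>mi_le e. c \<alpha> * mpow z \<alpha>) * (\<Sum>\<alpha>\<in>mi_le e. c \<alpha> * mpow z \<alpha>)"
    by (simp only: sum_product cnj_sum)
  also have "\<dots> = of_real ((cmod (\<Sum>\<alpha>\<in>mi_le e. c \<alpha> * mpow z \<alpha>))\<^sup>2)"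
    by (metis complex_norm_square mult.commute)
  finally show ?thesis .
qed

text \<open>The quadratic form of a localizing matrix at \<open>c\<close> is the Riesz functional of
  a square times \<open>\<phi>\<close>. Both directions of duality rest on this identity.\<close>

lemma riesz_gram_times:
  "riesz y (gram e c * \<phi>) = (\<Sum>\<alpha>\<in>mi_le e. \<Sum>\<beta>\<in>mi_le e. cnj (c \<alpha>) * loc_matrix \<phi> y \<alpha> \<beta> * c \<beta>)"
proof -
  have "riesz y (gram e c * \<phi>)
      = (\<Sum>\<alpha>\<in>mi_le e. \<Sum>\<beta>\<in>mi_le e. riesz y (Poly_Mapping.single (\<alpha>, \<beta>) (cnj (c \<alpha>) * c \<beta>) * \<phi>))"
    by (simp add: gram_def sum_distrib_right riesz_eq_pm_sum pm_sum_sum)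
  then show ?thesis
    by (simp only: riesz_eq_pm_sum loc_matrix_eq_riesz pm_sum_single_times) (simp add: mult_ac)
qed

lemma keys_mult_mi_le:
  assumes "Poly_Mapping.keys \<phi> \<subseteq> mi_le d \<times> mi_le d" "Poly_Mapping.keys \<psi> \<subseteq> mi_le e \<times> mi_le e"
  shows "Poly_Mapping.keys (\<phi> * \<psi>) \<subseteq> mi_le (d + e) \<times> mi_le (d + e)"
proof
  fix s assume "s \<in> Poly_Mapping.keys (\<phi> * \<psi>)"
  then obtain t u where "s = t + u" "t \<in> Poly_Mapping.keys \<phi>" "u \<in> Poly_Mapping.keys \<psi>"
    using keys_mult[of \<phi> \<psi>] by auto
  then show "s \<in> mi_le (d + e) \<times> mi_le (d + e)"
    using assms by (auto simp: mem_Times_iff intro: mi_le_add dest!: subsetD)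
qed

lemma keys_sum_subset:
  assumes "\<And>i. i \<in> I \<Longrightarrow> Poly_Mapping.keys (\<phi> i) \<subseteq> A"
  shows "Poly_Mapping.keys (\<Sum>i\<in>I. \<phi> i) \<subseteq> A"
  using assms
proof (induction I rule: infinite_finite_induct)
  case (insert i I)
  then show ?case using keys_add[of "\<phi> i" "\<Sum>i\<in>I. \<phi> i"] by auto
qed auto

lemma keys_gram: "Poly_Mapping.keys (gram e c) \<subseteq> mi_le e \<times> mi_le e"
  unfolding gram_def by (intro keys_sum_subset) auto

text \<open>Lifts \<open>\<sigma>\<close> from a function to a coefficient family, the sum of the
  Gram polynomials of its squares, to which the Riesz functional can be applied.\<close>

lemma hsos_certificate:
  fixes \<sigma> :: "complex ^ 'n::finite \<Rightarrow> real"
  assumes "\<sigma> \<in> hsos e"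
  obtains P :: "'n cpoly" where "\<And>\<phi> z. ceval (P * \<phi>) z = of_real (\<sigma> z) * ceval \<phi> z"
    and "\<And>\<phi> y. psd_on (mi_le e) (loc_matrix \<phi> y) \<Longrightarrow> 0 \<le> Re (riesz y (P * \<phi>))"
proof -
  obtain r :: nat and p where r: "1 \<le> r" and p: "\<forall>j\<in>{1..r}. p j \<in> hol_poly_le e"
    and \<sigma>: "\<sigma> = (\<lambda>z. \<Sum>j=1..r. (cmod (p j z))\<^sup>2)"
    using assms by (rule hsosE)
  have "\<forall>j. \<exists>c. j \<in> {1..r} \<longrightarrow> p j = (\<lambda>z. \<Sum>\<alpha>\<in>mi_le e. c \<alpha> * mpow z \<alpha>)"
    using p unfolding hol_poly_le_def mem_Collect_eq by metis
  then obtain c where c: "\<And>j. j \<in> {1..r} \<Longrightarrow> p j = (\<lambda>z. \<Sum>\<alpha>\<in>mi_le e. c j \<alpha> * mpow z \<alpha>)"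
    by metis
  let ?P = "\<Sum>j=1..r. gram e (c j)"
  show ?thesis
  proof (rule that[of ?P])
    fix \<phi> z
    have "ceval (?P * \<phi>) z = (\<Sum>j=1..r. ceval (gram e (c j) * \<phi>) z)"
      by (simp add: sum_distrib_right ceval_eq_pm_sum pm_sum_sum)
    also have "\<dots> = (\<Sum>j=1..r. of_real ((cmod (p j z))\<^sup>2) * ceval \<phi> z)"
      by (rule sum.cong) (simp_all add: ceval_gram_times c)
    finally show "ceval (?P * \<phi>) z = of_real (\<sigma> z) * ceval \<phi> z"
      by (simp add: \<sigma> sum_distrib_right)
  next
    fix \<phi> :: "'n cpoly" and y
    assume psd: "psd_on (mi_le e) (loc_matrix \<phi> y)"
    have "riesz y (?P * \<phi>) = (\<Sum>j=1..r. riesz y (gram e (c j) * \<phi>))"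
      by (simp add: sum_distrib_right riesz_eq_pm_sum pm_sum_sum)
    moreover have "0 \<le> Re (riesz y (gram e (c j) * \<phi>))" for j
      using psd by (simp add: psd_on_def riesz_gram_times)
    ultimately show "0 \<le> Re (riesz y (?P * \<phi>))"
      by (simp add: sum_nonneg)
  qed
qed

text \<open>Real-valued functions, with real parts of the constraints, are used so that the
  separation of real cones applies directly.\<close>

definition sos_cone ::
  "nat \<Rightarrow> (nat \<Rightarrow> ('n::finite) cpoly) \<Rightarrow> (nat \<Rightarrow> nat) \<Rightarrow> nat \<Rightarrow> (complex ^ 'n \<Rightarrow> real) set" where
  "sos_cone m g k d = {h. \<exists>\<sigma>. (\<forall>i\<in>{0..m}. \<sigma> i \<in> hsos (d - con_deg k i)) \<and>
     h = (\<lambda>z. \<Sum>i=0..m. \<sigma> i z * Re (ceval (con g i) z))}"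

lemma sos_coneI:
  "(\<And>i. i \<in> {0..m} \<Longrightarrow> \<sigma> i \<in> hsos (d - con_deg k i)) \<Longrightarrow>
   (\<lambda>z. \<Sum>i=0..m. \<sigma> i z * Re (ceval (con g i) z)) \<in> sos_cone m g k d"
  unfolding sos_cone_def mem_Collect_eq by (intro exI[of _ \<sigma>]) simp

lemma sos_coneE:
  assumes "h \<in> sos_cone m g k d"
  obtains \<sigma> where "\<forall>i\<in>{0..m}. \<sigma> i \<in> hsos (d - con_deg k i)"
    "h = (\<lambda>z. \<Sum>i=0..m. \<sigma> i z * Re (ceval (con g i) z))"
  using assms unfolding sos_cone_def mem_Collect_eq
  by (elim exE conjE) (rule that)

lemma sos_cone_add:
  assumes "u \<in> sos_cone m g k d" "v \<in> sos_cone m g k d"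
  shows "(\<lambda>z. u z + v z) \<in> sos_cone m g k d"
proof -
  obtain \<sigma> where \<sigma>: "\<forall>i\<in>{0..m}. \<sigma> i \<in> hsos (d - con_deg k i)"
    "u = (\<lambda>z. \<Sum>i=0..m. \<sigma> i z * Re (ceval (con g i) z))"
    using assms(1) by (rule sos_coneE)
  obtain \<tau> where \<tau>: "\<forall>i\<in>{0..m}. \<tau> i \<in> hsos (d - con_deg k i)"
    "v = (\<lambda>z. \<Sum>i=0..m. \<tau> i z * Re (ceval (con g i) z))"
    using assms(2) by (rule sos_coneE)
  have "(\<lambda>z. u z + v z) = (\<lambda>z. \<Sum>i=0..m. (\<sigma> i z + \<tau> i z) * Re (ceval (con g i) z))"
    by (simp add: \<sigma>(2) \<tau>(2) sum.distrib distrib_right)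
  also have "\<dots> \<in> sos_cone m g k d"
    by (intro sos_coneI hsos_add \<sigma>(1)[rule_format] \<tau>(1)[rule_format])
  finally show ?thesis .
qed

lemma sos_cone_scale:
  assumes "0 \<le> c" "v \<in> sos_cone m g k d"
  shows "(\<lambda>z. c * v z) \<in> sos_cone m g k d"
proof -
  obtain \<sigma> where \<sigma>: "\<forall>i\<in>{0..m}. \<sigma> i \<in> hsos (d - con_deg k i)"
    "v = (\<lambda>z. \<Sum>i=0..m. \<sigma> i z * Re (ceval (con g i) z))"
    using assms(2) by (rule sos_coneE)
  have "(\<lambda>z. c * v z) = (\<lambda>z. \<Sum>i=0..m. (c * \<sigma> i z) * Re (ceval (con g i) z))"
    by (simp add: \<sigma>(2) sum_distrib_left mult.assoc)
  also have "\<dots> \<in> sos_cone m g k d"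
    by (intro sos_coneI hsos_scale \<sigma>(1)[rule_format] assms)
  finally show ?thesis .
qed

lemma sos_cone_term:
  assumes "i \<in> {0..m}" "\<sigma> \<in> hsos (d - con_deg k i)"
  shows "(\<lambda>z. \<sigma> z * Re (ceval (con g i) z)) \<in> sos_cone m g k d"
proof -
  have "(\<lambda>z. \<Sum>j=0..m. (if j = i then \<sigma> else (\<lambda>z. 0)) z * Re (ceval (con g j) z)) \<in> sos_cone m g k d"
    by (rule sos_coneI) (use assms in \<open>simp add: hsos_0\<close>)
  moreover have "(\<Sum>j=0..m. (if j = i then \<sigma> else (\<lambda>z. 0)) z * Re (ceval (con g j) z))
      = \<sigma> z * Re (ceval (con g i) z)" for z
  proof -
    have "(\<Sum>j=0..m. (if j = i then \<sigma> else (\<lambda>z. 0)) z * Re (ceval (con g j) z))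
      = (\<Sum>j=0..m. if j = i then \<sigma> z * Re (ceval (con g j) z) else 0)"
      by (rule sum.cong) auto
    then show ?thesis using assms(1) by simp
  qed
  ultimately show ?thesis by simp
qed

lemma sos_cone_hsos: "\<sigma> \<in> hsos d \<Longrightarrow> \<sigma> \<in> sos_cone m g k d"
  using sos_cone_term[of 0 m \<sigma> d k g] by (simp add: con_def con_deg_def)

lemma sos_cone_0: "(\<lambda>z. 0) \<in> sos_cone m g k d"
  by (intro sos_cone_hsos hsos_0)

lemma sos_cone_const:
  assumes "0 \<le> c"
  shows "(\<lambda>z. c) \<in> sos_cone m g k d"
proof -
  have "(\<lambda>z. c * (cmod (1 * mpow z 0))\<^sup>2) \<in> sos_cone m g k d"
    by (intro sos_cone_scale assms sos_cone_hsos hsos_norm_square hol_poly_monom) (simp add: mi_le_iff)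
  then show ?thesis by simp
qed

lemma sos_cone_sum:
  assumes "\<And>s. s \<in> S \<Longrightarrow> v s \<in> sos_cone m g k d"
  shows "(\<lambda>z. \<Sum>s\<in>S. v s z) \<in> sos_cone m g k d"
  using assms
proof (induction S rule: infinite_finite_induct)
  case (insert s S)
  have "(\<lambda>z. v s z + (\<Sum>s\<in>S. v s z)) \<in> sos_cone m g k d"
    by (intro sos_cone_add insert.IH insert.prems insertI1 insertI2)
  then show ?case using insert.hyps by simp
qed (simp_all add: sos_cone_0)

section \<open>The ball constraint makes \<open>1\<close> an order unit\<close>

text \<open>Degrees are read off coefficients, so \<open>\<phi>\<close> is first identified with the
  explicit ball polynomial. The bound allows multipliers of degree up to \<open>d - 1\<close> on
  this constraint.\<close>

lemma ball_constraint_degree: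
  fixes \<phi> :: "('n::finite) cpoly"
  assumes "has_cdegree \<phi> l"
    and ball: "\<And>z. ceval \<phi> z = of_real (a - (\<Sum>j\<in>UNIV. (cmod (z $ j))\<^sup>2))"
  shows "l \<le> 1"
proof -
  let ?\<psi> = "Poly_Mapping.single 0 (of_real a)
    - (\<Sum>j\<in>UNIV. Poly_Mapping.single (axis j (Suc 0), axis j (Suc 0)) 1) :: 'n cpoly"
  have "\<phi> = ?\<psi>"
  proof (rule ceval_inject)
    fix z
    have "ceval ?\<psi> z = of_real a - (\<Sum>j\<in>UNIV. cnj (z $ j) * z $ j)"
      by (simp add: ceval_eq_pm_sum pm_sum_diff pm_sum_sum bmon_def[of "(_, _)"] mpow_vcnj mpow_axis vcnj_def)
    also have "\<dots> = of_real (a - (\<Sum>j\<in>UNIV. (cmod (z $ j))\<^sup>2))"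
      by (simp only: of_real_diff of_real_sum complex_norm_square mult.commute)
    finally show "ceval \<phi> z = ceval ?\<psi> z"
      using ball by simp
  qed
  moreover have "mi_deg \<alpha> \<le> 1" if "Poly_Mapping.lookup ?\<psi> (\<alpha>, \<beta>) \<noteq> 0" for \<alpha> \<beta>
  proof (rule ccontr)
    assume "\<not> mi_deg \<alpha> \<le> 1"
    then have "0 \<noteq> (\<alpha>, \<beta>)" "(axis j (Suc 0), axis j (Suc 0)) \<noteq> (\<alpha>, \<beta>)" for j
      by (auto simp: zero_prod_def)
    then have "Poly_Mapping.lookup ?\<psi> (\<alpha>, \<beta>) = 0"
      by (simp add: lookup_minus lookup_sum lookup_single_not_eq)
    with that show False by simp
  qed
  ultimately show ?thesis
    using assms(1) by (auto simp: has_cdegree_def)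
qed

text \<open>Induction on the degree, removing one variable at a time; each step multiplies the
  constant by \<open>R^2\<close>.\<close>

lemma sos_cone_monomial_bound:
  fixes g :: "nat \<Rightarrow> ('n::finite) cpoly"
  assumes i: "i \<in> {1..m}" "k i \<le> 1"
    and ball: "\<And>z. ceval (g i) z = of_real (R\<^sup>2 - (\<Sum>j\<in>UNIV. (cmod (z $ j))\<^sup>2))"
    and "mi_deg \<alpha> \<le> d"
  shows "\<exists>t. (\<lambda>z. t - (cmod (mpow z \<alpha>))\<^sup>2) \<in> sos_cone m g k d"
  using assms(4)
proof (induction "mi_deg \<alpha>" arbitrary: \<alpha>)
  case 0
  then have "\<alpha> = 0"
    by (simp add: mi_deg_def vec_eq_iff)
  then show ?case
    \<comment> \<open>The monomial is constantly \<open>1\<close>, so \<open>t = 1\<close> leaves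
      the zero function.\<close>
    using sos_cone_0[of m g k d] by (intro exI[of _ 1]) simp
next
  case (Suc n)
  have "\<exists>j. \<alpha> $ j \<noteq> 0"
  proof (rule ccontr)
    assume "\<nexists>j. \<alpha> $ j \<noteq> 0"
    then have "mi_deg \<alpha> = 0" by (simp add: mi_deg_def)
    with Suc.hyps(2) show False by simp
  qed
  then obtain j where j: "\<alpha> $ j \<noteq> 0" ..
  define \<beta> where "\<beta> = (\<chi> i. if i = j then \<alpha> $ i - 1 else \<alpha> $ i)"
  have \<alpha>: "\<alpha> = \<beta> + axis j (Suc 0)"
    using j by (auto simp: \<beta>_def axis_def vec_eq_iff)
  have deg: "mi_deg \<beta> = n"
    using Suc.hyps(2) by (simp add: \<alpha> mi_deg_add)
  obtain t where t: "(\<lambda>z. t - (cmod (mpow z \<beta>))\<^sup>2) \<in> sos_cone m g k d"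
    using Suc.hyps(1)[of \<beta>] deg Suc.prems Suc.hyps(2) by auto
  have 1: "(\<lambda>z. R\<^sup>2 * (t - (cmod (mpow z \<beta>))\<^sup>2)) \<in> sos_cone m g k d"
    by (intro sos_cone_scale t) simp
  \<comment> \<open>Here \<open>\<beta>\<close> has degree at most \<open>d - 1\<close> and
    \<open>k i \<le> 1\<close>, so the square of its monomial is an admissible multiplier of the
    ball constraint.\<close>
  have "\<beta> \<in> mi_le (d - con_deg k i)"
    using i deg Suc.prems Suc.hyps(2) by (auto simp: mi_le_iff con_deg_def)
  then have "(\<lambda>z. (cmod (1 * mpow z \<beta>))\<^sup>2 * Re (ceval (con g i) z)) \<in> sos_cone m g k d"
    using i by (intro sos_cone_term hsos_norm_square hol_poly_monom) auto
  then have 2: "(\<lambda>z. (cmod (mpow z \<beta>))\<^sup>2 * (R\<^sup>2 - (\<Sum>l\<in>UNIV. (cmod (z $ l))\<^sup>2))) \<in> sos_cone m g k d"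
    using i by (simp add: con_def ball)
  have 3: "(\<lambda>z. \<Sum>l\<in>UNIV - {j}. (cmod (1 * mpow z (\<beta> + axis l (Suc 0))))\<^sup>2) \<in> sos_cone m g k d"
    using deg Suc.prems Suc.hyps(2)
    by (intro sos_cone_sum sos_cone_hsos hsos_norm_square hol_poly_monom)
       (simp add: mi_le_iff mi_deg_add)
  \<comment> \<open>The ball term supplies \<open>-|z^\<beta>|^2 |z_l|^2\<close> for every
    coordinate \<open>l\<close>. The added squares cancel all of these except the one at
    \<open>j\<close>, which is \<open>-|z^\<alpha>|^2\<close>, and the terms
    \<open>R^2 |z^\<beta>|^2\<close> cancel as well.\<close>
  have "R\<^sup>2 * (t - (cmod (mpow z \<beta>))\<^sup>2) +
      ((cmod (mpow z \<beta>))\<^sup>2 * (R\<^sup>2 - (\<Sum>l\<in>UNIV. (cmod (z $ l))\<^sup>2)) +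
       (\<Sum>l\<in>UNIV - {j}. (cmod (1 * mpow z (\<beta> + axis l (Suc 0))))\<^sup>2))
      = R\<^sup>2 * t - (cmod (mpow z \<alpha>))\<^sup>2" for z
  proof -
    have "(\<Sum>l\<in>UNIV. (cmod (z $ l))\<^sup>2) = (cmod (z $ j))\<^sup>2 + (\<Sum>l\<in>UNIV - {j}. (cmod (z $ l))\<^sup>2)"
      by (rule sum.remove) auto
    moreover have "(\<Sum>l\<in>UNIV - {j}. (cmod (1 * mpow z (\<beta> + axis l (Suc 0))))\<^sup>2)
        = (cmod (mpow z \<beta>))\<^sup>2 * (\<Sum>l\<in>UNIV - {j}. (cmod (z $ l))\<^sup>2)"
      by (simp add: mpow_add mpow_axis norm_mult power_mult_distrib sum_distrib_left)
    moreover have "(cmod (mpow z \<alpha>))\<^sup>2 = (cmod (mpow z \<beta>))\<^sup>2 * (cmod (z $ j))\<^sup>2"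
      by (simp add: \<alpha> mpow_add mpow_axis norm_mult power_mult_distrib)
    ultimately show ?thesis
      by (simp only:) (simp add: algebra_simps)
  qed
  with sos_cone_add[OF 1 sos_cone_add[OF 2 3]]
  have "(\<lambda>z. R\<^sup>2 * t - (cmod (mpow z \<alpha>))\<^sup>2) \<in> sos_cone m g k d"
    by simp
  then show ?case ..
qed

text \<open>Polarization: the real part of \<open>conj a * b\<close> is half of
  \<open>|a + b|^2 - |a|^2 - |b|^2\<close>. The first square lies in the cone, and the negative
  squares do so after adding constants.\<close>

lemma sos_cone_order_unit_monomial:
  fixes g :: "nat \<Rightarrow> ('n::finite) cpoly"
  assumes bound: "\<And>\<alpha>. \<alpha> \<in> mi_le d \<Longrightarrow> \<exists>t. (\<lambda>z. t - (cmod (mpow z \<alpha>))\<^sup>2) \<in> sos_cone m g k d"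
    and "s \<in> mi_le d \<times> mi_le d"
  shows "\<exists>t. (\<lambda>z. Re (c * bmon s z) + t) \<in> sos_cone m g k d"
proof -
  obtain \<alpha> \<beta> where s: "s = (\<alpha>, \<beta>)" "\<alpha> \<in> mi_le d" "\<beta> \<in> mi_le d"
    using assms(2) by auto
  obtain t u where t: "(\<lambda>z. t - (cmod (mpow z \<alpha>))\<^sup>2) \<in> sos_cone m g k d"
    and u: "(\<lambda>z. u - (cmod (mpow z \<beta>))\<^sup>2) \<in> sos_cone m g k d"
    using bound s by metis
  have 1: "(\<lambda>z. 1 / 2 * (t - (cmod (mpow z \<alpha>))\<^sup>2)) \<in> sos_cone m g k d"
    by (intro sos_cone_scale t) simp
  have 2: "(\<lambda>z. (cmod c)\<^sup>2 / 2 * (u - (cmod (mpow z \<beta>))\<^sup>2)) \<in> sos_cone m g k d"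
    by (intro sos_cone_scale u) simp
  have 3: "(\<lambda>z. 1 / 2 * (cmod (1 * mpow z \<alpha> + c * mpow z \<beta>))\<^sup>2) \<in> sos_cone m g k d"
    by (intro sos_cone_scale sos_cone_hsos hsos_norm_square hol_poly_add hol_poly_monom s) simp
  have "1 / 2 * (t - (cmod (mpow z \<alpha>))\<^sup>2) + ((cmod c)\<^sup>2 / 2 * (u - (cmod (mpow z \<beta>))\<^sup>2)
      + 1 / 2 * (cmod (1 * mpow z \<alpha> + c * mpow z \<beta>))\<^sup>2) = Re (c * bmon s z) + (t / 2 + (cmod c)\<^sup>2 * u / 2)" for z
  proof -
    have polar: "(cmod (a + b))\<^sup>2 = (cmod a)\<^sup>2 + (cmod b)\<^sup>2 + 2 * Re (cnj a * b)" for a b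
      by (simp only: cmod_power2) (simp add: power2_eq_square algebra_simps)
    have "c * bmon s z = cnj (mpow z \<alpha>) * (c * mpow z \<beta>)"
      by (simp add: s bmon_def mpow_vcnj mult_ac)
    then show ?thesis
      by (simp only: polar norm_mult power_mult_distrib mult_1 norm_one) (simp add: field_simps)
  qed
  with sos_cone_add[OF 1 sos_cone_add[OF 2 3]]
  have "(\<lambda>z. Re (c * bmon s z) + (t / 2 + (cmod c)\<^sup>2 * u / 2)) \<in> sos_cone m g k d"
    by simp
  then show ?thesis ..
qed

text \<open>Every key contributes its own constant, and the finitely many constants add up. Real
  parts are taken term by term, so the coefficients need no symmetry.\<close>

lemma sos_cone_order_unit:
  fixes g :: "nat \<Rightarrow> ('n::finite) cpoly"
  assumes bound: "\<And>\<alpha>. \<alpha> \<in> mi_le d \<Longrightarrow> \<exists>t. (\<lambda>z. t - (cmod (mpow z \<alpha>))\<^sup>2) \<in> sos_cone m g k d"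
    and keys: "Poly_Mapping.keys \<phi> \<subseteq> mi_le d \<times> mi_le d"
  shows "\<exists>t. (\<lambda>z. Re (ceval \<phi> z) + t) \<in> sos_cone m g k d"
proof -
  have "\<forall>s. \<exists>t. s \<in> mi_le d \<times> mi_le d \<longrightarrow>
      (\<lambda>z. Re (Poly_Mapping.lookup \<phi> s * bmon s z) + t) \<in> sos_cone m g k d"
    using sos_cone_order_unit_monomial[OF bound] by blast
  then obtain t where t: "\<And>s. s \<in> mi_le d \<times> mi_le d \<Longrightarrow>
      (\<lambda>z. Re (Poly_Mapping.lookup \<phi> s * bmon s z) + t s) \<in> sos_cone m g k d"
    by metis
  have "(\<lambda>z. \<Sum>s\<in>Poly_Mapping.keys \<phi>. Re (Poly_Mapping.lookup \<phi> s * bmon s z) + t s) \<in> sos_cone m g k d"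
    using keys by (intro sos_cone_sum t) auto
  moreover have "(\<Sum>s\<in>Poly_Mapping.keys \<phi>. Re (Poly_Mapping.lookup \<phi> s * bmon s z) + t s)
      = Re (ceval \<phi> z) + (\<Sum>s\<in>Poly_Mapping.keys \<phi>. t s)" for z
    by (simp only: ceval_eq_pm_sum pm_sum_def sum.distrib Re_sum)
  ultimately show ?thesis
    by (intro exI[of _ "\<Sum>s\<in>Poly_Mapping.keys \<phi>. t s"]) simp
qed

section \<open>Duality\<close>

lemma real_cpoly_le_D:
  assumes "\<phi> \<in> real_cpoly_le e"
  shows "Poly_Mapping.keys \<phi> \<subseteq> mi_le e \<times> mi_le e" and "ceval \<phi> z = of_real (Re (ceval \<phi> z))"
  using assms by (auto simp: real_cpoly_le_def)

lemma mi_le_mono: "d \<le> e \<Longrightarrow> mi_le d \<subseteq> mi_le e"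
  by (auto simp: mi_le_iff)

text \<open>Weak duality: each term of the certificate has nonnegative Riesz value by the
  semidefinite condition on its localizing matrix.\<close>

lemma riesz_ge_if_sos:
  fixes f :: "('n::finite) cpoly"
  assumes y: "y \<in> moment_feasible m g k d"
    and \<sigma>: "\<And>i. i \<in> {0..m} \<Longrightarrow> \<sigma> i \<in> hsos (d - con_deg k i)"
    and eq: "\<And>z. ceval f z - of_real l = (\<Sum>i=0..m. of_real (\<sigma> i z) * ceval (con g i) z)"
  shows "l \<le> Re (riesz y f)"
proof -
  have "\<forall>i. \<exists>P. i \<in> {0..m} \<longrightarrow> (\<forall>\<phi> z. ceval (P * \<phi>) z = of_real (\<sigma> i z) * ceval \<phi> z) \<and>
      (\<forall>\<phi> y. psd_on (mi_le (d - con_deg k i)) (loc_matrix \<phi> y) \<longrightarrow> 0 \<le> Re (riesz y (P * \<phi>)))"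
  proof
    fix i
    show "\<exists>P. i \<in> {0..m} \<longrightarrow> (\<forall>\<phi> z. ceval (P * \<phi>) z = of_real (\<sigma> i z) * ceval \<phi> z) \<and>
      (\<forall>\<phi> y. psd_on (mi_le (d - con_deg k i)) (loc_matrix \<phi> y) \<longrightarrow> 0 \<le> Re (riesz y (P * \<phi>)))"
    proof (cases "i \<in> {0..m}")
      case True
      obtain P :: "'n cpoly" where "\<And>\<phi> z. ceval (P * \<phi>) z = of_real (\<sigma> i z) * ceval \<phi> z"
        and "\<And>\<phi> y. psd_on (mi_le (d - con_deg k i)) (loc_matrix \<phi> y) \<Longrightarrow> 0 \<le> Re (riesz y (P * \<phi>))"
        by (rule hsos_certificate[OF \<sigma>[OF True]]) blast
      then show ?thesis by blast
    qed blast
  qed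
  from choice[OF this] obtain P where
    P: "\<And>i \<phi> z. i \<in> {0..m} \<Longrightarrow> ceval (P i * \<phi>) z = of_real (\<sigma> i z) * ceval \<phi> z"
    and pos: "\<And>i \<phi> y. i \<in> {0..m} \<Longrightarrow> psd_on (mi_le (d - con_deg k i)) (loc_matrix \<phi> y) \<Longrightarrow>
      0 \<le> Re (riesz y (P i * \<phi>))"
    by blast
  \<comment> \<open>The identity of values becomes one of coefficients; applying
    \<open>riesz y\<close> then turns the constant \<open>l\<close> into \<open>l * y 0 0\<close>,
    which is \<open>l\<close>.\<close>
  have "f - Poly_Mapping.single 0 (of_real l) = (\<Sum>i=0..m. P i * con g i)"
  proof (rule ceval_inject)
    fix z
    have "ceval (f - Poly_Mapping.single 0 (of_real l)) z = ceval f z - of_real l"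
      by (simp add: ceval_eq_pm_sum pm_sum_diff)
    also have "\<dots> = (\<Sum>i=0..m. ceval (P i * con g i) z)"
      unfolding eq by (rule sum.cong) (simp_all add: P)
    finally show "ceval (f - Poly_Mapping.single 0 (of_real l)) z = ceval (\<Sum>i=0..m. P i * con g i) z"
      by (simp add: ceval_eq_pm_sum pm_sum_sum)
  qed
  from arg_cong[OF this, of "riesz y"]
  have "riesz y f - of_real l * y 0 0 = (\<Sum>i=0..m. riesz y (P i * con g i))"
    by (simp add: riesz_eq_pm_sum pm_sum_diff pm_sum_sum)
  moreover have "y 0 0 = 1"
    using y by (simp add: moment_feasible_def)
  moreover have "0 \<le> Re (\<Sum>i=0..m. riesz y (P i * con g i))"
    unfolding Re_sum using y by (intro sum_nonneg pos) (simp_all add: moment_feasible_def)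
  ultimately have "0 \<le> Re (riesz y f - l)"
    by simp
  then show ?thesis by simp
qed

text \<open>All polynomials involved are real-valued, so passing to real parts loses
  nothing.\<close>

lemma sos_cone_iff_certificate:
  fixes f :: "('n::finite) cpoly"
  assumes f: "f \<in> real_cpoly_le e"
    and g: "\<forall>i\<in>{0..m}. con g i \<in> real_cpoly_le (con_deg k i)"
  shows "(\<lambda>z. Re (ceval f z) - l) \<in> sos_cone m g k d \<longleftrightarrow>
    (\<exists>\<sigma>. (\<forall>i\<in>{0..m}. \<sigma> i \<in> hsos (d - con_deg k i)) \<and>
       (\<forall>z. ceval f z - of_real l = (\<Sum>i=0..m. of_real (\<sigma> i z) * ceval (con g i) z)))"
proof -
  have "(\<Sum>i=0..m. of_real (\<sigma> i z) * ceval (con g i) z)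
      = complex_of_real (\<Sum>i=0..m. \<sigma> i z * Re (ceval (con g i) z))" for \<sigma> z
    unfolding of_real_sum of_real_mult by (rule sum.cong) (simp_all flip: real_cpoly_le_D(2)[OF g[rule_format]])
  moreover have "ceval f z - of_real l = of_real (Re (ceval f z) - l)" for z
    by (simp flip: real_cpoly_le_D(2)[OF f])
  ultimately show ?thesis
    unfolding sos_cone_def mem_Collect_eq fun_eq_iff by (simp only: of_real_eq_iff)
qed

text \<open>The moments \<open>y\<^sub>\<alpha>\<^sub>\<beta>\<close> are the values, on the real and imaginary parts of the monomials, of a
  functional that is nonnegative on the cone of weighted sums of squares.\<close>

lemma moment_if_not_sos:
  fixes f :: "('n::finite) cpoly"
  assumes f: "Poly_Mapping.keys f \<subseteq> mi_le d \<times> mi_le d"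
    and g: "\<And>i. i \<in> {0..m} \<Longrightarrow> con g i \<in> real_cpoly_le (con_deg k i)"
    and k: "\<And>i. i \<in> {0..m} \<Longrightarrow> con_deg k i \<le> d"
    and unit: "\<And>\<phi>. Poly_Mapping.keys \<phi> \<subseteq> mi_le d \<times> mi_le d \<Longrightarrow>
      \<exists>t. (\<lambda>z. Re (ceval \<phi> z) + t) \<in> sos_cone m g k d"
    and not_sos: "(\<lambda>z. Re (ceval f z) - l) \<notin> sos_cone m g k d"
  obtains y where "y \<in> moment_feasible m g k d" "Re (riesz y f) \<le> l"
proof -
  define I where "I = (mi_le d \<times> mi_le d :: ((nat ^ 'n) \<times> (nat ^ 'n)) set)"
  \<comment> \<open>The real vector space on which the functional lives. Taking real parts of
    arbitrary coefficient families avoids a symmetry condition on the coefficients.\<close>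
  define V where "V = {h. \<exists>\<phi> :: 'n cpoly. Poly_Mapping.keys \<phi> \<subseteq> I \<and> h = (\<lambda>z. Re (ceval \<phi> z))}"
  have V_I: "(\<lambda>z. Re (ceval \<phi> z)) \<in> V" if "Poly_Mapping.keys \<phi> \<subseteq> I" for \<phi> :: "'n cpoly"
    unfolding V_def mem_Collect_eq using that by (intro exI[of _ \<phi>]) simp
  have V_E: "\<exists>\<phi> :: 'n cpoly. Poly_Mapping.keys \<phi> \<subseteq> I \<and> v = (\<lambda>z. Re (ceval \<phi> z))" if "v \<in> V" for v
    using that unfolding V_def mem_Collect_eq .
  have keys_scale: "Poly_Mapping.keys (Poly_Mapping.single 0 a * \<phi>) \<subseteq> I" if "Poly_Mapping.keys \<phi> \<subseteq> I"
    for a and \<phi> :: "'n cpoly"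
  proof
    fix s assume "s \<in> Poly_Mapping.keys (Poly_Mapping.single 0 a * \<phi>)"
    then obtain t u where "s = t + u" "t \<in> Poly_Mapping.keys (Poly_Mapping.single 0 a)" "u \<in> Poly_Mapping.keys \<phi>"
      using keys_mult[of "Poly_Mapping.single 0 a" \<phi>] by blast
    moreover from this(2) have "t = 0" by (cases "a = 0") auto
    ultimately show "s \<in> I" using that by auto
  qed
  have zero_I: "0 \<in> I"
    by (simp add: I_def zero_prod_def mi_le_iff)
  have ceval_scale: "ceval (Poly_Mapping.single 0 a * \<phi>) z = a * ceval \<phi> z" for a z and \<phi> :: "'n cpoly"
    by (simp add: ceval_single_times)
  have V_scale: "(\<lambda>z. c * v z) \<in> V" if v: "v \<in> V" for c v
  proof -
    obtain \<phi> :: "'n cpoly" where \<phi>: "Poly_Mapping.keys \<phi> \<subseteq> I" "v = (\<lambda>z. Re (ceval \<phi> z))"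
      using V_E[OF v] by (elim exE conjE)
    show ?thesis
      using V_I[OF keys_scale[OF \<phi>(1), of "of_real c"]] by (simp add: \<phi>(2) ceval_scale)
  qed
  have V_add: "(\<lambda>z. u z + v z) \<in> V" if uv: "u \<in> V" "v \<in> V" for u v
  proof -
    obtain \<phi> \<psi> :: "'n cpoly" where \<phi>: "Poly_Mapping.keys \<phi> \<subseteq> I" "u = (\<lambda>z. Re (ceval \<phi> z))"
      and \<psi>: "Poly_Mapping.keys \<psi> \<subseteq> I" "v = (\<lambda>z. Re (ceval \<psi> z))"
      using V_E[OF uv(1)] V_E[OF uv(2)] by (elim exE conjE)
    have "Poly_Mapping.keys (\<phi> + \<psi>) \<subseteq> I"
      using keys_add[of \<phi> \<psi>] \<phi>(1) \<psi>(1) by auto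
    from V_I[OF this] show ?thesis
      by (simp add: \<phi>(2) \<psi>(2) ceval_eq_pm_sum pm_sum_add)
  qed
  have keys_1: "Poly_Mapping.keys (1 :: 'n cpoly) \<subseteq> I"
    using zero_I by (simp flip: single_one)
  have one_V: "(\<lambda>z. 1) \<in> V"
    using V_I[OF keys_1] by simp
  have unit': "\<exists>t. (\<lambda>z. v z + t * 1) \<in> sos_cone m g k d" if v: "v \<in> V" for v
  proof -
    obtain \<phi> :: "'n cpoly" where \<phi>: "Poly_Mapping.keys \<phi> \<subseteq> I" "v = (\<lambda>z. Re (ceval \<phi> z))"
      using V_E[OF v] by (elim exE conjE)
    show ?thesis
      using unit[OF \<phi>(1)[unfolded I_def]] by (simp add: \<phi>(2))
  qed
  have x_V: "(\<lambda>z. Re (ceval f z) - l) \<in> V"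
    using V_add[OF V_I[OF f[folded I_def]] V_scale[OF one_V, of "- l"]] by simp
  have one_C: "(\<lambda>z. 1) \<in> sos_cone m g k d"
    by (rule sos_cone_const) simp
  obtain L where L: "\<forall>u\<in>V. \<forall>v\<in>V. L (\<lambda>z. u z + v z) = L u + L v"
    "\<forall>v\<in>V. \<forall>c. L (\<lambda>z. c * v z) = c * L v"
    "\<forall>v\<in>V. v \<in> sos_cone m g k d \<longrightarrow> 0 \<le> L v"
    and L_1: "L (\<lambda>z. 1) = 1" and L_x: "L (\<lambda>z. Re (ceval f z) - l) \<le> 0"
    by (rule cone_separation[where C = "sos_cone m g k d" and V = V and e = "\<lambda>z. 1",
          OF sos_cone_add sos_cone_scale one_C V_scale V_add unit' x_V not_sos])
  note L_add = L(1)[rule_format] and L_scale = L(2)[rule_format] and L_pos = L(3)[rule_format]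
  have L_0: "L (\<lambda>z. 0) = 0"
    using L_scale[OF one_V, of 0] by simp
  have zero_V: "(\<lambda>z. 0) \<in> V"
    using V_scale[OF one_V, of 0] by simp
  have mono_V: "(\<lambda>z. Re (c * bmon s z)) \<in> V" if "s \<in> I" for c s
    using V_I[of "Poly_Mapping.single s c"] that by (simp add: ceval_eq_pm_sum)
  \<comment> \<open>The complex-linear extension of \<open>L\<close>, evaluated at the monomials.
    Imaginary parts lie in \<open>V\<close> because they are real parts after multiplication by
    \<open>- \<i>\<close>.\<close>
  define \<Lambda> where "\<Lambda> s = Complex (L (\<lambda>z. Re (bmon s z))) (L (\<lambda>z. Im (bmon s z)))" for s
  have L_mono: "L (\<lambda>z. Re (c * bmon s z)) = Re (c * \<Lambda> s)" if s: "s \<in> I" for c s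
  proof -
    have re: "(\<lambda>z. Re (bmon s z)) \<in> V" and im: "(\<lambda>z. Im (bmon s z)) \<in> V"
      using mono_V[OF s, of 1] mono_V[OF s, of "- \<i>"] by simp_all
    have "L (\<lambda>z. Re (c * bmon s z)) = L (\<lambda>z. Re c * Re (bmon s z) + (- Im c) * Im (bmon s z))"
      by simp
    also have "\<dots> = Re c * L (\<lambda>z. Re (bmon s z)) + (- Im c) * L (\<lambda>z. Im (bmon s z))"
      by (simp only: L_add[OF V_scale[OF re] V_scale[OF im]] L_scale[OF re] L_scale[OF im])
    finally show ?thesis by (simp add: \<Lambda>_def)
  qed
  have L_sum: "(\<lambda>z. \<Sum>s\<in>S. Re (c s * bmon s z)) \<in> V \<and>
      L (\<lambda>z. \<Sum>s\<in>S. Re (c s * bmon s z)) = (\<Sum>s\<in>S. Re (c s * \<Lambda> s))"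
    if "finite S" "S \<subseteq> I" for S c
    using that
  proof (induction S)
    case empty
    then show ?case using zero_V L_0 by simp
  next
    case (insert s S)
    then have s: "s \<in> I" and IH: "(\<lambda>z. \<Sum>s\<in>S. Re (c s * bmon s z)) \<in> V"
      "L (\<lambda>z. \<Sum>s\<in>S. Re (c s * bmon s z)) = (\<Sum>s\<in>S. Re (c s * \<Lambda> s))" by auto
    show ?case
      using V_add[OF mono_V[OF s, of "c s"] IH(1)] L_add[OF mono_V[OF s, of "c s"] IH(1)]
      by (simp only: sum.insert[OF insert.hyps] IH(2) L_mono[OF s])
  qed
  \<comment> \<open>The value \<open>0\<close> outside \<open>I\<close> is the convention built into
    \<open>herm_fam\<close>.\<close>
  define y where "y \<alpha> \<beta> = (if (\<alpha>, \<beta>) \<in> I then \<Lambda> (\<alpha>, \<beta>) else 0)" for \<alpha> \<beta>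
  have y: "y (fst s) (snd s) = \<Lambda> s" if "s \<in> I" for s
    using that by (simp add: y_def)
  have Re_riesz: "Re (riesz y \<phi>) = L (\<lambda>z. Re (ceval \<phi> z))" if \<phi>: "Poly_Mapping.keys \<phi> \<subseteq> I" for \<phi>
  proof -
    have "Re (riesz y \<phi>) = (\<Sum>s\<in>Poly_Mapping.keys \<phi>. Re (Poly_Mapping.lookup \<phi> s * \<Lambda> s))"
      unfolding riesz_eq_pm_sum pm_sum_def Re_sum by (intro sum.cong refl) (simp only: y[OF subsetD[OF \<phi>]])
    also have "\<dots> = L (\<lambda>z. \<Sum>s\<in>Poly_Mapping.keys \<phi>. Re (Poly_Mapping.lookup \<phi> s * bmon s z))"
      using L_sum[OF finite_keys \<phi>] by simp
    also have "\<dots> = L (\<lambda>z. Re (ceval \<phi> z))"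
      by (simp only: ceval_eq_pm_sum pm_sum_def Re_sum)
    finally show ?thesis .
  qed
  have riesz_scale: "riesz y (Poly_Mapping.single 0 a * \<phi>) = a * riesz y \<phi>" for a and \<phi> :: "'n cpoly"
    by (simp add: riesz_eq_pm_sum pm_sum_single_times)
  have Im_riesz: "Im (riesz y \<phi>) = L (\<lambda>z. Im (ceval \<phi> z))" if \<phi>: "Poly_Mapping.keys \<phi> \<subseteq> I" for \<phi>
    using Re_riesz[OF keys_scale[OF \<phi>, of "- \<i>"]] by (simp add: riesz_scale ceval_scale)
  \<comment> \<open>Conjugate polynomials have conjugate Riesz values. This gives the Hermitian
    symmetry both of \<open>y\<close> and of the localizing matrices.\<close>
  have riesz_cnj: "riesz y \<psi> = cnj (riesz y \<phi>)"
    if \<phi>: "Poly_Mapping.keys \<phi> \<subseteq> I" and \<psi>: "Poly_Mapping.keys \<psi> \<subseteq> I"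
      and cnj: "\<And>z. ceval \<psi> z = cnj (ceval \<phi> z)" for \<phi> \<psi>
  proof -
    have "(\<lambda>z. Im (ceval \<phi> z)) \<in> V"
      using V_I[OF keys_scale[OF \<phi>, of "- \<i>"]] by (simp add: ceval_scale)
    from L_scale[OF this, of "- 1"] have "Im (riesz y \<psi>) = - Im (riesz y \<phi>)"
      by (simp add: Im_riesz[OF \<phi>] Im_riesz[OF \<psi>] cnj)
    moreover have "Re (riesz y \<psi>) = Re (riesz y \<phi>)"
      by (simp add: Re_riesz[OF \<phi>] Re_riesz[OF \<psi>] cnj)
    ultimately show ?thesis by (simp add: complex_eq_iff)
  qed
  have riesz_single: "riesz y (Poly_Mapping.single (\<alpha>, \<beta>) 1) = y \<alpha> \<beta>" for \<alpha> \<beta>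
    by (simp add: riesz_eq_pm_sum)
  have "y \<in> herm_fam d"
    unfolding herm_fam_def mem_Collect_eq
  proof (intro conjI ballI allI impI)
    fix \<alpha> \<beta> :: "nat ^ 'n" assume "\<alpha> \<in> mi_le d" "\<beta> \<in> mi_le d"
    then have "riesz y (Poly_Mapping.single (\<beta>, \<alpha>) 1) = cnj (riesz y (Poly_Mapping.single (\<alpha>, \<beta>) 1))"
      by (intro riesz_cnj) (simp_all add: I_def ceval_eq_pm_sum cnj_bmon)
    then show "cnj (y \<alpha> \<beta>) = y \<beta> \<alpha>"
      by (simp add: riesz_single)
  next
    fix \<alpha> \<beta> :: "nat ^ 'n" assume "\<not> (\<alpha> \<in> mi_le d \<and> \<beta> \<in> mi_le d)"
    then show "y \<alpha> \<beta> = 0" by (auto simp: y_def I_def)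
  qed
  moreover have "y 0 0 = 1"
  proof -
    have "riesz y 1 = y 0 0"
      by (simp add: riesz_eq_pm_sum flip: single_one)
    then show ?thesis
      using Re_riesz[OF keys_1] Im_riesz[OF keys_1] L_1 L_0 by (simp add: complex_eq_iff)
  qed
  moreover have "psd_on (mi_le (d - con_deg k i)) (loc_matrix (con g i) y)" if i: "i \<in> {0..m}" for i
    unfolding psd_on_def
  proof (intro conjI ballI allI)
    let ?\<phi> = "con g i" and ?e = "d - con_deg k i"
    note g_keys = real_cpoly_le_D(1)[OF g[OF i]] and g_real = real_cpoly_le_D(2)[OF g[OF i]]
    \<comment> \<open>Since \<open>con_deg k i \<le> d\<close>, the truncated subtraction is exact
      and the product has degree at most \<open>d\<close> in each variable group, where
      \<open>L\<close> controls the moments.\<close>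
    have keys: "Poly_Mapping.keys (P * ?\<phi>) \<subseteq> I" if "Poly_Mapping.keys P \<subseteq> mi_le ?e \<times> mi_le ?e" for P
      using keys_mult_mi_le[OF that g_keys] k[OF i] by (simp add: I_def)
    {
      fix \<alpha> \<beta> :: "nat ^ 'n" assume "\<alpha> \<in> mi_le ?e" "\<beta> \<in> mi_le ?e"
      moreover have "cnj (ceval ?\<phi> z) = ceval ?\<phi> z" for z
        by (subst (1 2) g_real) simp
      ultimately have "riesz y (Poly_Mapping.single (\<beta>, \<alpha>) 1 * ?\<phi>)
          = cnj (riesz y (Poly_Mapping.single (\<alpha>, \<beta>) 1 * ?\<phi>))"
        by (intro riesz_cnj keys) (simp_all add: ceval_single_times cnj_bmon)
      then show "cnj (loc_matrix ?\<phi> y \<alpha> \<beta>) = loc_matrix ?\<phi> y \<beta> \<alpha>"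
        by (simp add: loc_matrix_eq_riesz)
    next
      fix v :: "nat ^ 'n \<Rightarrow> complex"
      have "(\<Sum>\<alpha>\<in>mi_le ?e. \<Sum>\<beta>\<in>mi_le ?e. cnj (v \<alpha>) * loc_matrix ?\<phi> y \<alpha> \<beta> * v \<beta>)
          = riesz y (gram ?e v * ?\<phi>)"
        by (simp only: riesz_gram_times)
      \<comment> \<open>The quadratic form is the value of \<open>L\<close> at a square times
        \<open>con g i\<close>, a member of the cone.\<close>
      then have "Re (\<Sum>\<alpha>\<in>mi_le ?e. \<Sum>\<beta>\<in>mi_le ?e. cnj (v \<alpha>) * loc_matrix ?\<phi> y \<alpha> \<beta> * v \<beta>)
          = L (\<lambda>z. Re (ceval (gram ?e v * ?\<phi>) z))"
        by (simp only: Re_riesz[OF keys[OF keys_gram]])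
      moreover have "(\<lambda>z. Re (ceval (gram ?e v * ?\<phi>) z)) \<in> sos_cone m g k d"
      proof -
        have "(\<lambda>z. \<Sum>\<alpha>\<in>mi_le ?e. v \<alpha> * mpow z \<alpha>) \<in> hol_poly_le ?e"
          unfolding hol_poly_le_def mem_Collect_eq by (intro exI[of _ v] refl)
        from sos_cone_term[OF i hsos_norm_square[OF this]] show ?thesis
          by (simp add: ceval_gram_times)
      qed
      ultimately show "0 \<le> Re (\<Sum>\<alpha>\<in>mi_le ?e. \<Sum>\<beta>\<in>mi_le ?e. cnj (v \<alpha>) * loc_matrix ?\<phi> y \<alpha> \<beta> * v \<beta>)"
        using L_pos[OF V_I[OF keys[OF keys_gram]]] by simp
    }
  qed
  ultimately have "y \<in> moment_feasible m g k d"
    unfolding moment_feasible_def by simp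
  moreover have "Re (riesz y f) \<le> l"
    using L_x L_add[OF V_I[OF f[folded I_def]] V_scale[OF one_V, of "- l"]] L_scale[OF one_V, of "- l"] L_1
    by (simp add: Re_riesz[OF f[folded I_def]])
  ultimately show ?thesis by (rule that)
qed

theorem proposition3p10:
  fixes f :: "('n::finite) cpoly" and g :: "nat \<Rightarrow> 'n cpoly"
    and m kf :: nat and k :: "nat \<Rightarrow> nat"
    and K :: "(complex ^ 'n) set" and R :: real
  assumes "m \<ge> 1"
    and "f \<in> real_cpoly" and "\<forall>i\<in>{1..m}. g i \<in> real_cpoly"
    and "has_cdegree f kf" and "\<forall>i\<in>{1..m}. has_cdegree (g i) (k i)"
    and "K = {z. \<forall>i\<in>{1..m}. Re (ceval (g i) z) \<ge> 0}"
    and "R > 0"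
    and "\<exists>i\<in>{1..m}. \<forall>z. ceval (g i) z = of_real (R\<^sup>2 - (\<Sum>j\<in>UNIV. (cmod (z $ j))\<^sup>2))"
    and "\<exists>i\<in>{1..m}. \<forall>z. ceval (g i) z = of_real (- (R\<^sup>2 - (\<Sum>j\<in>UNIV. (cmod (z $ j))\<^sup>2)))"
  shows "\<forall>d \<ge> Max (insert kf (k ` {1..m})).
           rho_star m f g k d = rho m f g k d \<and> rho m f g k d \<in> range ereal \<union> {\<infinity>}"
proof (intro allI impI)
  fix d assume d: "Max (insert kf (k ` {1..m})) \<le> d"
  have kf: "kf \<le> d" and k: "\<And>i. i \<in> {1..m} \<Longrightarrow> k i \<le> d"
    using d by (simp_all add: Max_le_iff)
  have f_le: "f \<in> real_cpoly_le kf"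
    using assms(4) by (simp add: has_cdegree_def)
  have f_keys: "Poly_Mapping.keys f \<subseteq> mi_le d \<times> mi_le d"
    using real_cpoly_le_D(1)[OF f_le] mi_le_mono[OF kf] by blast
  have con_k: "con_deg k i \<le> d" if "i \<in> {0..m}" for i
    using k that by (simp add: con_deg_def)
  have con_le: "con g i \<in> real_cpoly_le (con_deg k i)" if "i \<in> {0..m}" for i
  proof (cases "i = 0")
    case True
    then show ?thesis
      by (simp add: con_def con_deg_def real_cpoly_le_def) (simp add: mi_le_iff zero_prod_def flip: single_one)
  next
    case False
    then show ?thesis
      using assms(5) that by (simp add: con_def con_deg_def has_cdegree_def)
  qed
  then have "\<forall>i\<in>{0..m}. con g i \<in> real_cpoly_le (con_deg k i)" ..
  note cert = sos_cone_iff_certificate[OF f_le this]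
  obtain i where i: "i \<in> {1..m}"
    and ball: "\<And>z. ceval (g i) z = of_real (R\<^sup>2 - (\<Sum>j\<in>UNIV. (cmod (z $ j))\<^sup>2))"
    using assms(8) by blast
  have "k i \<le> 1"
    using assms(5) i by (intro ball_constraint_degree[OF _ ball]) auto
  then have bound: "\<exists>t. (\<lambda>z. t - (cmod (mpow z \<alpha>))\<^sup>2) \<in> sos_cone m g k d" if "\<alpha> \<in> mi_le d" for \<alpha>
    using sos_cone_monomial_bound[where \<alpha> = \<alpha> and g = g, OF i _ ball] that by (simp add: mi_le_iff)
  have unit: "\<exists>t. (\<lambda>z. Re (ceval \<phi> z) + t) \<in> sos_cone m g k d"
    if "Poly_Mapping.keys \<phi> \<subseteq> mi_le d \<times> mi_le d" for \<phi>
    by (rule sos_cone_order_unit[OF bound that])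
  have rho_star: "rho_star m f g k d = Sup (ereal ` {l. (\<lambda>z. Re (ceval f z) - l) \<in> sos_cone m g k d})"
    unfolding rho_star_def cert ..
  have weak: "rho_star m f g k d \<le> rho m f g k d"
    unfolding rho_star_def rho_def
  proof (rule Sup_least, rule INF_greatest)
    fix x y
    assume y: "y \<in> moment_feasible m g k d"
      and "x \<in> ereal ` {l. \<exists>\<sigma>. (\<forall>i\<in>{0..m}. \<sigma> i \<in> hsos (d - con_deg k i)) \<and>
        (\<forall>z. ceval f z - of_real l = (\<Sum>i=0..m. of_real (\<sigma> i z) * ceval (con g i) z))}"
    then obtain l \<sigma> where x: "x = ereal l" and \<sigma>: "\<forall>i\<in>{0..m}. \<sigma> i \<in> hsos (d - con_deg k i)"
      and eq: "\<forall>z. ceval f z - of_real l = (\<Sum>i=0..m. of_real (\<sigma> i z) * ceval (con g i) z)"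
      by (elim imageE CollectE exE conjE)
    show "x \<le> ereal (Re (riesz y f))"
      unfolding x ereal_less_eq
      by (rule riesz_ge_if_sos[OF y \<sigma>[rule_format] eq[rule_format]])
  qed
  \<comment> \<open>It suffices to treat real \<open>l\<close> below \<open>rho\<close>. Without a
    certificate for \<open>l\<close>, separation would give a feasible \<open>y\<close> of value at
    most \<open>l\<close>.\<close>
  have strong: "rho m f g k d \<le> rho_star m f g k d"
  proof (rule dense_le)
    fix x assume x: "x < rho m f g k d"
    show "x \<le> rho_star m f g k d"
    proof (cases x)
      case (real l)
      have "(\<lambda>z. Re (ceval f z) - l) \<in> sos_cone m g k d"
      proof (rule ccontr)
        assume not_sos: "(\<lambda>z. Re (ceval f z) - l) \<notin> sos_cone m g k d"
        obtain y where y: "y \<in> moment_feasible m g k d" "Re (riesz y f) \<le> l"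
          by (rule moment_if_not_sos[OF f_keys con_le con_k unit not_sos])
        then have "rho m f g k d \<le> ereal l"
          unfolding rho_def by (intro INF_lower2[OF y(1)]) simp
        with x real show False by simp
      qed
      then show ?thesis
        unfolding rho_star real by (intro Sup_upper imageI CollectI)
    qed (use x in auto)
  qed
  \<comment> \<open>The order unit yields the certified lower bound \<open>- t\<close>, which
    excludes the value \<open>- \<infinity>\<close>; the value \<open>\<infinity>\<close> remains
    possible for an empty feasible set.\<close>
  obtain t where t: "(\<lambda>z. Re (ceval f z) + t) \<in> sos_cone m g k d"
    using unit[OF f_keys] ..
  then have "ereal (- t) \<le> rho_star m f g k d"
    unfolding rho_star by (intro Sup_upper imageI CollectI) simp
  then have "rho m f g k d \<noteq> - \<infinity>"
    using weak by auto
  then have "rho m f g k d \<in> range ereal \<union> {\<infinity>}"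
    by (cases "rho m f g k d") auto
  with weak strong show "rho_star m f g k d = rho m f g k d \<and> rho m f g k d \<in> range ereal \<union> {\<infinity>}"
    by (intro conjI antisym)
qed

end
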